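(* Let $G$ and $g$ satisfy the standing assumptions (S1)–(S4), and let $C_0>0$ be the constant (determined by the Lipschitz constant of $G$ in $\gamma$) such that $\bar\alpha\le C_0|\sigma_0^{-1}|^2$. Assume there exist $\sigma_0:[0,T]\times\mathbb{R}^d\to\mathbb{R}^{d\times d}_+$ and a small constant $\varepsilon_0>0$ such that $\sigma_0$ and $\sigma_0^{-1}$ are bounded and, for all $(t,x)$, $$\theta(t,x)\le\frac{\varepsilon_0}{4dC_0}\quad\text{and}\quad\frac{\underline\alpha(t,x)}{|\sigma_0^{-1}(t,x)|^2}\ge\varepsilon_0,$$ where $\theta,\underline\alpha$ are the functions associated to $\sigma_0$. Then Assumption (M) holds, and consequently $\mathbb{T}^t_h$ (built from a pair as in Assumption (M)) is monotone for all sufficiently small $h$: there is $h_0>0$ such that for all $h\in(0,h_0]$, $\mathbb{T}^t_h[\varphi]\le\mathbb{T}^t_h[\psi]$ whenever $\varphi\le\psi$.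
   Context: Notation. $T>0$, $d\ge1$; $\mathbb{S}^d$ is the set of symmetric $d\times d$ matrices with its usual partial order ($\gamma\le\tilde\gamma$ iff $\tilde\gamma-\gamma$ is nonnegative definite); $\mathbb{R}^{d\times d}_+$ is the set of nondegenerate (invertible) $d\times d$ matrices. $\gamma:\tilde\gamma=\operatorname{tr}(\gamma\tilde\gamma^\top)$, $|\gamma|=\sqrt{\gamma:\gamma}$. For a matrix $\gamma$, $D[\gamma]$ is the diagonal matrix with the same diagonal entries as $\gamma$. $\sigma^{-\top}:=(\sigma^{-1})^\top$. $\mathbf 0$ is the zero of $\mathbb{R}^d$ or $\mathbb{S}^d$. Data: $G:[0,T]\times\mathbb{R}^d\times\mathbb{R}\times\mathbb{R}^d\times\mathbb{S}^d\to\mathbb{R}$, $(t,x,y,z,\gamma)\mapsto G$, and $g:\mathbb{R}^d\to\mathbb{R}$; the PDE is $-\partial_tu-G(t,x,u,Du,D^2u)=0$ on $[0,T)\times\mathbb{R}^d$, $u(T,\cdot)=g$. For notational convenience $G$ is assumed differentiable in $(y,z,\gamma)$; $G_\gamma$ is the ($\mathbb{S}^d$-valued) derivative in $\gamma$. Viscosity solutions. An upper (resp. lower) semicontinuous $u$ is a viscosity subsolution (resp. supersolution) of the PDE if $u(T,\cdot)\le g$ (resp. $\ge g$) and for every $(t,x)\in[0,T)\times\mathbb{R}^d$ and smooth $\varphi$ with $[u-\varphi](t,x)=0\ge[u-\varphi](s,y)$ (resp. $\le$) for all $(s,y)\in[0,T]\times\mathbb{R}^d$, one has $[-\partial_t\varphi-G(\cdot,\varphi,D\varphi,D^2\varphi)](t,x)\le0$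 (resp. $\ge0$). Standing assumptions. (S1) $G(\cdot,0,\mathbf 0,\mathbf 0)$ and $g$ are bounded. (S2) $G$ is continuous in $t$ and uniformly Lipschitz continuous in $(x,y,z,\gamma)$; $g$ is uniformly Lipschitz continuous. (S3) $G$ is nondecreasing in $\gamma$. (S4) Comparison holds for the PDE in the class of bounded viscosity solutions: if $u_1,u_2$ are bounded viscosity sub- and supersolutions respectively, then $u_1\le u_2$. Scheme. Given $\sigma_0:[0,T]\times\mathbb{R}^d\to\mathbb{R}^{d\times d}_+$ and $p:[0,T]\times\mathbb{R}^d\to(0,1)$ with $\sigma_0,\sigma_0^{-1},p^{-1}$ bounded, put $a_0=\sigma_0\sigma_0^\top$, $F(t,x,y,z,\gamma)=G(t,x,y,z,\gamma)-\frac12a_0(t,x):\gamma$, and $\widetilde G_\gamma=\sigma_0^{-1}G_\gamma\sigma_0^{-\top}$ (with $\sigma_0=\sigma_0(t,x)$). For each $(t,x)$ let $\xi=\xi^{t,x}$ be an $\mathbb{R}^d$-valued random variable with i.i.d. components, $\mathbb{P}(\xi_i=\pm1/\sqrt p)=p/2$ for each sign, $\mathbb{P}(\xi_i=0)=1-p$, $p=p(t,x)$. For $t\in[0,T)$, $h>0$ with $t+h\le T$, and bounded measurable $\varphi:\mathbb{R}^d\to\mathbb{R}$, define (with $\sigma_0,p,\xi$ taken at $(t,x)$) $$\mathcal{D}^{t,i}_h\varphi(x)=\mathbb{E}[\varphi(x+\sqrt h\,\sigma_0\xi)K_i(\xi)],\ i=0,1,2,\quad K_0=1,\quad K_1(\xi)=\frac{\sigma_0^{-\top}\xi}{\sqrt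 h},$$ $$K_2(\xi)=\frac{\sigma_0^{-\top}\big[(1-p)\xi\xi^\top-(1-3p)D[\xi\xi^\top]-2pI_d\big]\sigma_0^{-1}}{(1-p)h},$$ $$\mathbb{T}^t_h[\varphi](x)=\mathcal{D}^{t,0}_h\varphi(x)+hF\big(t,x,\mathcal{D}^{t,0}_h\varphi(x),\mathcal{D}^{t,1}_h\varphi(x),\mathcal{D}^{t,2}_h\varphi(x)\big).$$ Assumption (M): there exist $\sigma_0,p$ (the $\sigma_0$ here need not be the one given in the claim; e.g. it may be a positive scalar-function multiple of it) with $\sigma_0,\sigma_0^{-1},p^{-1}$ bounded satisfying (M1), (M2) below. Associated to $\sigma_0$ define $\underline\alpha(t,x)=\sup\{\alpha>0:\alpha I_d\le D[\widetilde G_\gamma](t,x,y,z,\gamma)\ \forall(y,z,\gamma)\}$, $\bar\alpha(t,x)=\inf\{\alpha>0:\alpha I_d\ge D[\widetilde G_\gamma](t,x,y,z,\gamma)\ \forall(y,z,\gamma)\}$, $\Lambda=\bar\alpha/\underline\alpha$, $\theta(t,x)=\inf\{\theta\ge0:D[\widetilde G_\gamma]\le(1+\theta)\widetilde G_\gamma\ \forall (y,z,\gamma)\}$, and for $p\in(0,1)$ $$\alpha_p=\frac{p(2+3\theta)-\theta}{p(1+\theta)},\quad c_p=\sqrt{2p\Lambda+\alpha_p-2p},\quad \lambda_p=\sqrt p\Big[(1-p+pd)c_p-\frac{2pd\Lambda}{c_p}\Big]\frac{\sqrt{\underline\alpha}}{|\sigma_0^{-1}|},$$ $$\lambda^*=\inf_{(t,x)\in[0,T]\times\mathbb{R}^d}\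 \sup_{p\in[\frac{\theta}{2(1+\theta)},\frac13]\cap(0,\frac13]}\lambda_p(t,x).$$ (M1) $\theta(t,x)\le2$ for all $(t,x)$ and $\lambda^*>0$. (M2) For all $(t,x)$, with $p=p(t,x)$: $p\in[\frac{\theta}{2(1+\theta)},\frac13]\cap(0,\frac13]$, $\lambda_p\ge\lambda^*/2$, and $\underline\alpha=c_p^{-2}$. *)

theory Defs
  imports "HOL-Probability.Probability" "HOL-Probability.Product_PMF"
begin

section \<open>Matrices\<close>

definition Sym :: "(real^'n^'n) set" where
  "Sym = {A. transpose A = A}"

definition psd_le :: "real^'n^'n \<Rightarrow> real^'n^'n \<Rightarrow> bool" (infix "\<preceq>" 50) where
  "A \<preceq> B \<longleftrightarrow> (\<forall>v. 0 \<le> v \<bullet> ((B - A) *v v))"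

text \<open>The associated norm is the library norm of \<^typ>\<open>real^'n^'n\<close>; see
  \<open>frob_eq_inner\<close> below.\<close>
definition frob :: "real^'n^'n \<Rightarrow> real^'n^'n \<Rightarrow> real" (infix "::\<^sub>F" 70) where
  "A ::\<^sub>F B = trace (A ** transpose B)"

definition diag_part :: "real^'n^'n \<Rightarrow> real^'n^'n" where
  "diag_part A = (\<chi> i j. if i = j then A $ i $ j else 0)"

definition outer_sq :: "real^'n \<Rightarrow> real^'n^'n" where
  "outer_sq v = (\<chi> i j. v $ i * v $ j)"

lemma frob_eq_inner: "A ::\<^sub>F B = A \<bullet> B"
  by (simp add: frob_def trace_def matrix_matrix_mult_def transpose_def inner_vec_def)


section \<open>Viscosity solutions\<close>

primrec Ck :: "nat \<Rightarrow> ('a::euclidean_space \<Rightarrow> real) \<Rightarrow> bool" where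
  "Ck 0 f \<longleftrightarrow> continuous_on UNIV f"
| "Ck (Suc k) f \<longleftrightarrow> (\<forall>z. f differentiable at z) \<and>
     (\<forall>v. Ck k (\<lambda>z. frechet_derivative f (at z) v))"

definition smooth :: "('a::euclidean_space \<Rightarrow> real) \<Rightarrow> bool" where
  "smooth f \<longleftrightarrow> (\<forall>k. Ck k f)"

definition time_deriv :: "(real \<times> (real^'n) \<Rightarrow> real) \<Rightarrow> real \<Rightarrow> real^'n \<Rightarrow> real" where
  "time_deriv \<phi> t x = deriv (\<lambda>s. \<phi> (s, x)) t"

definition grad :: "(real^'n \<Rightarrow> real) \<Rightarrow> real^'n \<Rightarrow> real^'n" where
  "grad f x = (\<chi> i. frechet_derivative f (at x) (axis i 1))"

definition hessian :: "(real^'n \<Rightarrow> real) \<Rightarrow> real^'n \<Rightarrow> real^'n^'n" where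
  "hessian f x = (\<chi> i j. frechet_derivative (\<lambda>y. grad f y $ j) (at x) (axis i 1))"

definition usc_on :: "'a::topological_space set \<Rightarrow> ('a \<Rightarrow> real) \<Rightarrow> bool" where
  "usc_on S f \<longleftrightarrow> (\<forall>z\<in>S. \<forall>c. f z < c \<longrightarrow> (\<forall>\<^sub>F w in at z within S. f w < c))"

definition lsc_on :: "'a::topological_space set \<Rightarrow> ('a \<Rightarrow> real) \<Rightarrow> bool" where
  "lsc_on S f \<longleftrightarrow> usc_on S (\<lambda>z. - f z)"

text \<open>The nonlinearity \<open>G t x y z \<gamma>\<close> is a total function of which only the values with
  \<open>t \<in> {0..T}\<close> and \<open>\<gamma> \<in> Sym\<close> are ever constrained or used.\<close>
type_synonym 'n nonlin = "real \<Rightarrow> real^'n \<Rightarrow> real \<Rightarrow> real^'n \<Rightarrow> real^'n^'n \<Rightarrow> real"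

text \<open>Functions smooth on the closed strip \<open>{0..T} \<times> UNIV\<close> (up to the boundary) are exactly the
  restrictions of functions smooth on the whole space, so test functions are taken globally
  smooth; the touching condition only concerns the strip.\<close>

definition visc_subsol ::
    "real \<Rightarrow> 'n::finite nonlin \<Rightarrow> (real^'n \<Rightarrow> real) \<Rightarrow> (real \<times> (real^'n) \<Rightarrow> real) \<Rightarrow> bool" where
  "visc_subsol T G g u \<longleftrightarrow>
     usc_on ({0..T} \<times> UNIV) u \<and> (\<forall>x. u (T, x) \<le> g x) \<and>
     (\<forall>t\<in>{0..<T}. \<forall>x. \<forall>\<phi>. smooth \<phi> \<and> u (t, x) - \<phi> (t, x) = 0 \<and>
        (\<forall>s\<in>{0..T}. \<forall>y. u (s, y) - \<phi> (s, y) \<le> 0) \<longrightarrow>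
        - time_deriv \<phi> t x
          - G t x (\<phi> (t, x)) (grad (\<lambda>y. \<phi> (t, y)) x) (hessian (\<lambda>y. \<phi> (t, y)) x) \<le> 0)"

definition visc_supersol ::
    "real \<Rightarrow> 'n::finite nonlin \<Rightarrow> (real^'n \<Rightarrow> real) \<Rightarrow> (real \<times> (real^'n) \<Rightarrow> real) \<Rightarrow> bool" where
  "visc_supersol T G g u \<longleftrightarrow>
     lsc_on ({0..T} \<times> UNIV) u \<and> (\<forall>x. u (T, x) \<ge> g x) \<and>
     (\<forall>t\<in>{0..<T}. \<forall>x. \<forall>\<phi>. smooth \<phi> \<and> u (t, x) - \<phi> (t, x) = 0 \<and>
        (\<forall>s\<in>{0..T}. \<forall>y. u (s, y) - \<phi> (s, y) \<ge> 0) \<longrightarrow>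
        - time_deriv \<phi> t x
          - G t x (\<phi> (t, x)) (grad (\<lambda>y. \<phi> (t, y)) x) (hessian (\<lambda>y. \<phi> (t, y)) x) \<ge> 0)"


section \<open>Standing assumptions\<close>

definition G_differentiable :: "real \<Rightarrow> 'n::finite nonlin \<Rightarrow> bool" where
  "G_differentiable T G \<longleftrightarrow> (\<forall>t\<in>{0..T}. \<forall>x y z. \<forall>\<gamma>\<in>Sym.
     (\<lambda>(y, z, \<gamma>). G t x y z \<gamma>) differentiable (at (y, z, \<gamma>) within UNIV \<times> UNIV \<times> Sym))"

definition S1 :: "real \<Rightarrow> 'n::finite nonlin \<Rightarrow> (real^'n \<Rightarrow> real) \<Rightarrow> bool" where
  "S1 T G g \<longleftrightarrow> bounded ((\<lambda>(t, x). G t x 0 0 0) ` ({0..T} \<times> UNIV)) \<and> bounded (range g)"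

definition S2 :: "real \<Rightarrow> 'n::finite nonlin \<Rightarrow> (real^'n \<Rightarrow> real) \<Rightarrow> bool" where
  "S2 T G g \<longleftrightarrow>
     (\<forall>x y z. \<forall>\<gamma>\<in>Sym. continuous_on {0..T} (\<lambda>t. G t x y z \<gamma>)) \<and>
     (\<exists>L. \<forall>t\<in>{0..T}.
        L-lipschitz_on (UNIV \<times> UNIV \<times> UNIV \<times> Sym) (\<lambda>(x, y, z, \<gamma>). G t x y z \<gamma>)) \<and>
     (\<exists>L. L-lipschitz_on UNIV g)"

definition S3 :: "real \<Rightarrow> 'n::finite nonlin \<Rightarrow> bool" where
  "S3 T G \<longleftrightarrow> (\<forall>t\<in>{0..T}. \<forall>x y z. \<forall>\<gamma>\<in>Sym. \<forall>\<gamma>'\<in>Sym.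
     \<gamma> \<preceq> \<gamma>' \<longrightarrow> G t x y z \<gamma> \<le> G t x y z \<gamma>')"

definition S4 :: "real \<Rightarrow> 'n::finite nonlin \<Rightarrow> (real^'n \<Rightarrow> real) \<Rightarrow> bool" where
  "S4 T G g \<longleftrightarrow> (\<forall>u1 u2.
     visc_subsol T G g u1 \<and> bounded (u1 ` ({0..T} \<times> UNIV)) \<and>
     visc_supersol T G g u2 \<and> bounded (u2 ` ({0..T} \<times> UNIV)) \<longrightarrow>
     (\<forall>t\<in>{0..T}. \<forall>x. u1 (t, x) \<le> u2 (t, x)))"


section \<open>Quantities associated with \<open>\<sigma>\<^sub>0\<close>\<close>

type_synonym 'n mfield = "real \<Rightarrow> real^'n \<Rightarrow> real^'n^'n"

text \<open>The derivative within \<^const>\<open>Sym\<close> only determines the linear functional on \<^const>\<open>Sym\<close>;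
  its representing matrix is unique once required to be symmetric.\<close>
definition G_gamma :: "'n::finite nonlin \<Rightarrow>
    real \<Rightarrow> real^'n \<Rightarrow> real \<Rightarrow> real^'n \<Rightarrow> real^'n^'n \<Rightarrow> real^'n^'n" where
  "G_gamma G t x y z \<gamma> =
     (THE A. A \<in> Sym \<and> ((\<lambda>\<eta>. G t x y z \<eta>) has_derivative (\<lambda>\<eta>. A ::\<^sub>F \<eta>)) (at \<gamma> within Sym))"

definition Gt_gamma :: "'n::finite nonlin \<Rightarrow> 'n mfield \<Rightarrow>
    real \<Rightarrow> real^'n \<Rightarrow> real \<Rightarrow> real^'n \<Rightarrow> real^'n^'n \<Rightarrow> real^'n^'n" where
  "Gt_gamma G \<sigma> t x y z \<gamma> =
     matrix_inv (\<sigma> t x) ** G_gamma G t x y z \<gamma> ** transpose (matrix_inv (\<sigma> t x))"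

text \<open>These are extended-real valued so that the supremum or infimum of an empty set is
  \<open>-\<infinity>\<close> resp. \<open>\<infinity>\<close>, not an unspecified real number.\<close>

definition alpha_low :: "'n::finite nonlin \<Rightarrow> 'n mfield \<Rightarrow> real \<Rightarrow> real^'n \<Rightarrow> ereal" where
  "alpha_low G \<sigma> t x = Sup (ereal ` {\<alpha>. \<alpha> > 0 \<and>
     (\<forall>y z. \<forall>\<gamma>\<in>Sym. \<alpha> *\<^sub>R mat 1 \<preceq> diag_part (Gt_gamma G \<sigma> t x y z \<gamma>))})"

definition alpha_high :: "'n::finite nonlin \<Rightarrow> 'n mfield \<Rightarrow> real \<Rightarrow> real^'n \<Rightarrow> ereal" where
  "alpha_high G \<sigma> t x = Inf (ereal ` {\<alpha>. \<alpha> > 0 \<and>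
     (\<forall>y z. \<forall>\<gamma>\<in>Sym. diag_part (Gt_gamma G \<sigma> t x y z \<gamma>) \<preceq> \<alpha> *\<^sub>R mat 1)})"

definition theta :: "'n::finite nonlin \<Rightarrow> 'n mfield \<Rightarrow> real \<Rightarrow> real^'n \<Rightarrow> ereal" where
  "theta G \<sigma> t x = Inf (ereal ` {\<theta>. \<theta> \<ge> 0 \<and>
     (\<forall>y z. \<forall>\<gamma>\<in>Sym. diag_part (Gt_gamma G \<sigma> t x y z \<gamma>)
                      \<preceq> (1 + \<theta>) *\<^sub>R Gt_gamma G \<sigma> t x y z \<gamma>)})"

text \<open>From here on the real values are used. An infinite \<^const>\<open>theta\<close> violates the bound
  \<open>theta \<le> 2\<close> in \<open>M1\<close> below; an infinite or vanishing \<^const>\<open>alpha_low\<close> is mapped to \<open>0\<close>, which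
  makes \<open>lambda_p\<close> vanish and violates \<open>lambda_star > 0\<close>; \<^const>\<open>alpha_high\<close> is finite as soon as
  \<open>G\<close> is Lipschitz in \<open>\<gamma>\<close>.\<close>

definition Lam :: "'n::finite nonlin \<Rightarrow> 'n mfield \<Rightarrow> real \<Rightarrow> real^'n \<Rightarrow> real" where
  "Lam G \<sigma> t x = real_of_ereal (alpha_high G \<sigma> t x) / real_of_ereal (alpha_low G \<sigma> t x)"

definition alpha_p :: "'n::finite nonlin \<Rightarrow> 'n mfield \<Rightarrow> real \<Rightarrow> real^'n \<Rightarrow> real \<Rightarrow> real" where
  "alpha_p G \<sigma> t x p = (let \<theta> = real_of_ereal (theta G \<sigma> t x) in
     (p * (2 + 3 * \<theta>) - \<theta>) / (p * (1 + \<theta>)))"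

definition c_p :: "'n::finite nonlin \<Rightarrow> 'n mfield \<Rightarrow> real \<Rightarrow> real^'n \<Rightarrow> real \<Rightarrow> real" where
  "c_p G \<sigma> t x p = sqrt (2 * p * Lam G \<sigma> t x + alpha_p G \<sigma> t x p - 2 * p)"

definition lambda_p :: "'n::finite nonlin \<Rightarrow> 'n mfield \<Rightarrow> real \<Rightarrow> real^'n \<Rightarrow> real \<Rightarrow> real" where
  "lambda_p G \<sigma> t x p = (let d = real CARD('n); c = c_p G \<sigma> t x p in
     sqrt p * ((1 - p + p * d) * c - 2 * p * d * Lam G \<sigma> t x / c)
       * (sqrt (real_of_ereal (alpha_low G \<sigma> t x)) / norm (matrix_inv (\<sigma> t x))))"

definition p_range :: "'n::finite nonlin \<Rightarrow> 'n mfield \<Rightarrow> real \<Rightarrow> real^'n \<Rightarrow> real set" where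
  "p_range G \<sigma> t x = (let \<theta> = real_of_ereal (theta G \<sigma> t x) in
     {\<theta> / (2 * (1 + \<theta>)) .. 1/3} \<inter> {0<..1/3})"

definition lambda_star :: "real \<Rightarrow> 'n::finite nonlin \<Rightarrow> 'n mfield \<Rightarrow> ereal" where
  "lambda_star T G \<sigma> =
     (INF (t, x) \<in> {0..T} \<times> UNIV. SUP p \<in> p_range G \<sigma> t x. ereal (lambda_p G \<sigma> t x p))"


section \<open>The assumption for monotonicity\<close>

definition admissible_sigma :: "real \<Rightarrow> 'n::finite mfield \<Rightarrow> bool" where
  "admissible_sigma T \<sigma> \<longleftrightarrow>
     (\<forall>t\<in>{0..T}. \<forall>x. invertible (\<sigma> t x)) \<and>
     bounded ((\<lambda>(t, x). \<sigma> t x) ` ({0..T} \<times> UNIV)) \<and>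
     bounded ((\<lambda>(t, x). matrix_inv (\<sigma> t x)) ` ({0..T} \<times> UNIV))"

definition admissible_p :: "real \<Rightarrow> (real \<Rightarrow> real^'n::finite \<Rightarrow> real) \<Rightarrow> bool" where
  "admissible_p T p \<longleftrightarrow>
     (\<forall>t\<in>{0..T}. \<forall>x. p t x \<in> {0<..<1}) \<and>
     bounded ((\<lambda>(t, x). inverse (p t x)) ` ({0..T} \<times> UNIV))"

definition M1 :: "real \<Rightarrow> 'n::finite nonlin \<Rightarrow> 'n mfield \<Rightarrow> bool" where
  "M1 T G \<sigma> \<longleftrightarrow> (\<forall>t\<in>{0..T}. \<forall>x. theta G \<sigma> t x \<le> 2) \<and> lambda_star T G \<sigma> > 0"

definition M2 :: "real \<Rightarrow> 'n::finite nonlin \<Rightarrow> 'n mfield \<Rightarrow> (real \<Rightarrow> real^'n \<Rightarrow> real) \<Rightarrow> bool" where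
  "M2 T G \<sigma> p \<longleftrightarrow> (\<forall>t\<in>{0..T}. \<forall>x.
     p t x \<in> p_range G \<sigma> t x \<and>
     ereal (lambda_p G \<sigma> t x (p t x)) \<ge> lambda_star T G \<sigma> / 2 \<and>
     alpha_low G \<sigma> t x = ereal (c_p G \<sigma> t x (p t x) powi (-2)))"

definition M_pair ::
    "real \<Rightarrow> 'n::finite nonlin \<Rightarrow> 'n mfield \<Rightarrow> (real \<Rightarrow> real^'n \<Rightarrow> real) \<Rightarrow> bool" where
  "M_pair T G \<sigma> p \<longleftrightarrow> admissible_sigma T \<sigma> \<and> admissible_p T p \<and> M1 T G \<sigma> \<and> M2 T G \<sigma> p"

definition assumption_M :: "real \<Rightarrow> 'n::finite nonlin \<Rightarrow> bool" where
  "assumption_M T G \<longleftrightarrow> (\<exists>\<sigma> p. M_pair T G \<sigma> p)"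


section \<open>The scheme\<close>

definition xi_comp_pmf :: "real \<Rightarrow> real pmf" where
  "xi_comp_pmf p = pmf_of_list [(1 / sqrt p, p / 2), (- 1 / sqrt p, p / 2), (0, 1 - p)]"

text \<open>The law of a random vector with i.i.d. components; \<^const>\<open>Pi_pmf\<close> is the product law, and
  its default value \<open>0\<close> is immaterial because the index set is \<^const>\<open>UNIV\<close>.\<close>
definition xi_pmf :: "real \<Rightarrow> (real^'n::finite) pmf" where
  "xi_pmf p = map_pmf (\<lambda>f. \<chi> i. f i) (Pi_pmf UNIV 0 (\<lambda>_. xi_comp_pmf p))"

definition K1 :: "real \<Rightarrow> real^'n^'n \<Rightarrow> real^'n::finite \<Rightarrow> real^'n" where
  "K1 h S \<xi> = (1 / sqrt h) *\<^sub>R (transpose (matrix_inv S) *v \<xi>)"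

definition K2 :: "real \<Rightarrow> real^'n^'n \<Rightarrow> real \<Rightarrow> real^'n::finite \<Rightarrow> real^'n^'n" where
  "K2 h S p \<xi> = (1 / ((1 - p) * h)) *\<^sub>R
     (transpose (matrix_inv S)
      ** ((1 - p) *\<^sub>R outer_sq \<xi> - (1 - 3 * p) *\<^sub>R diag_part (outer_sq \<xi>) - (2 * p) *\<^sub>R mat 1)
      ** matrix_inv S)"

text \<open>The arguments \<open>S\<close> and \<open>p\<close> are the values of \<open>\<sigma>\<^sub>0\<close> and \<open>p\<close> at the current \<open>(t, x)\<close>.\<close>

definition D0 :: "real \<Rightarrow> real^'n^'n \<Rightarrow> real \<Rightarrow> (real^'n::finite \<Rightarrow> real) \<Rightarrow> real^'n \<Rightarrow> real" where
  "D0 h S p \<phi> x = measure_pmf.expectation (xi_pmf p) (\<lambda>\<xi>. \<phi> (x + sqrt h *\<^sub>R (S *v \<xi>)))"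

definition D1 :: "real \<Rightarrow> real^'n^'n \<Rightarrow> real \<Rightarrow> (real^'n::finite \<Rightarrow> real) \<Rightarrow> real^'n \<Rightarrow> real^'n" where
  "D1 h S p \<phi> x =
     measure_pmf.expectation (xi_pmf p) (\<lambda>\<xi>. \<phi> (x + sqrt h *\<^sub>R (S *v \<xi>)) *\<^sub>R K1 h S \<xi>)"

definition D2 :: "real \<Rightarrow> real^'n^'n \<Rightarrow> real \<Rightarrow> (real^'n::finite \<Rightarrow> real) \<Rightarrow> real^'n \<Rightarrow> real^'n^'n" where
  "D2 h S p \<phi> x =
     measure_pmf.expectation (xi_pmf p) (\<lambda>\<xi>. \<phi> (x + sqrt h *\<^sub>R (S *v \<xi>)) *\<^sub>R K2 h S p \<xi>)"

definition F_nl :: "'n::finite nonlin \<Rightarrow> 'n mfield \<Rightarrow> 'n nonlin" where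
  "F_nl G \<sigma> t x y z \<gamma> = G t x y z \<gamma> - 1/2 * ((\<sigma> t x ** transpose (\<sigma> t x)) ::\<^sub>F \<gamma>)"

definition Th :: "'n::finite nonlin \<Rightarrow> 'n mfield \<Rightarrow> (real \<Rightarrow> real^'n \<Rightarrow> real) \<Rightarrow>
    real \<Rightarrow> real \<Rightarrow> (real^'n \<Rightarrow> real) \<Rightarrow> real^'n \<Rightarrow> real" where
  "Th G \<sigma> p h t \<phi> x = (let S = \<sigma> t x; q = p t x in
     D0 h S q \<phi> x + h * F_nl G \<sigma> t x (D0 h S q \<phi> x) (D1 h S q \<phi> x) (D2 h S q \<phi> x))"

definition Th_monotone :: "real \<Rightarrow> 'n::finite nonlin \<Rightarrow> 'n mfield \<Rightarrow>
    (real \<Rightarrow> real^'n \<Rightarrow> real) \<Rightarrow> real \<Rightarrow> bool" where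
  "Th_monotone T G \<sigma> p h \<longleftrightarrow> (\<forall>t \<phi> \<psi>.
     0 \<le> t \<and> t < T \<and> t + h \<le> T \<and>
     \<phi> \<in> borel_measurable borel \<and> bounded (range \<phi>) \<and>
     \<psi> \<in> borel_measurable borel \<and> bounded (range \<psi>) \<and> (\<forall>x. \<phi> x \<le> \<psi> x) \<longrightarrow>
     (\<forall>x. Th G \<sigma> p h t \<phi> x \<le> Th G \<sigma> p h t \<psi> x))"


section \<open>The constant \<open>C\<^sub>0\<close>\<close>

definition alpha_high_const :: "real \<Rightarrow> 'n::finite nonlin \<Rightarrow> real \<Rightarrow> bool" where
  "alpha_high_const T G C \<longleftrightarrow> C > 0 \<and>
     (\<forall>\<sigma>. (\<forall>t\<in>{0..T}. \<forall>x. invertible (\<sigma> t x)) \<longrightarrow>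
        (\<forall>t\<in>{0..T}. \<forall>x. alpha_high G \<sigma> t x \<le> ereal (C * (norm (matrix_inv (\<sigma> t x)))\<^sup>2)))"

text \<open>Such a constant exists: every Lipschitz constant of \<open>G\<close> in \<open>\<gamma>\<close> is one.\<close>

lemma G_gamma_exists:
  assumes "G_differentiable T G" "t \<in> {0..T}" "\<gamma> \<in> Sym"
  shows "\<exists>A\<in>Sym. ((\<lambda>\<eta>. G t x y z \<eta>) has_derivative (\<lambda>\<eta>. A ::\<^sub>F \<eta>)) (at \<gamma> within Sym)"
proof -
  obtain D where D: "((\<lambda>(y, z, \<gamma>). G t x y z \<gamma>) has_derivative D)
      (at (y, z, \<gamma>) within UNIV \<times> UNIV \<times> Sym)"
    using assms unfolding G_differentiable_def differentiable_def by blast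
  have "((\<lambda>\<eta>. (y, z, \<eta>)) has_derivative (\<lambda>\<eta>. (0, 0, \<eta>))) (at \<gamma> within Sym)"
    by (auto intro!: derivative_eq_intros)
  moreover have "((\<lambda>(y, z, \<gamma>). G t x y z \<gamma>) has_derivative D)
      (at (y, z, \<gamma>) within (\<lambda>\<eta>. (y, z, \<eta>)) ` Sym)"
    by (rule has_derivative_subset[OF D]) auto
  ultimately have d: "((\<lambda>\<eta>. G t x y z \<eta>) has_derivative (\<lambda>\<eta>. D (0, 0, \<eta>))) (at \<gamma> within Sym)"
    by (auto dest: diff_chain_within simp: o_def)
  then have lin: "linear (\<lambda>\<eta>. D (0, 0, \<eta>))"
    by (rule has_derivative_linear)
  define A0 where "A0 = adjoint (\<lambda>\<eta>. D (0, 0, \<eta>)) 1"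
  have A0: "D (0, 0, \<eta>) = A0 \<bullet> \<eta>" for \<eta>
    using adjoint_works[OF lin, of \<eta> 1] by (simp add: A0_def inner_commute)
  define A where "A = (1/2) *\<^sub>R (A0 + transpose A0)"
  have "A \<in> Sym"
    by (simp add: A_def Sym_def transpose_def vec_eq_iff)
  have "transpose A0 \<bullet> transpose \<eta> = A0 \<bullet> \<eta>" for \<eta>
    by (simp add: inner_vec_def transpose_def) (rule sum.swap)
  then have A: "A \<bullet> \<eta> = D (0, 0, \<eta>)" if "\<eta> \<in> Sym" for \<eta>
    using that by (simp add: A_def A0 Sym_def inner_add_left) (metis)
  have diff: "\<eta> - \<gamma> \<in> Sym" if "\<eta> \<in> Sym" for \<eta>
    using that \<open>\<gamma> \<in> Sym\<close> by (simp add: Sym_def transpose_def vec_eq_iff)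
  have "((\<lambda>\<eta>. G t x y z \<eta>) has_derivative (\<lambda>\<eta>. A \<bullet> \<eta>)) (at \<gamma> within Sym)"
    unfolding has_derivative_within_alt
  proof (intro conjI allI impI)
    show "bounded_linear (\<lambda>\<eta>. A \<bullet> \<eta>)"
      by (rule bounded_linear_inner_right)
    fix e :: real assume "e > 0"
    then obtain r where "r > 0" and r: "\<And>\<eta>. \<eta> \<in> Sym \<Longrightarrow> norm (\<eta> - \<gamma>) < r \<Longrightarrow>
        norm (G t x y z \<eta> - G t x y z \<gamma> - D (0, 0, \<eta> - \<gamma>)) \<le> e * norm (\<eta> - \<gamma>)"
      using d unfolding has_derivative_within_alt by blast
    then show "\<exists>r>0. \<forall>\<eta>\<in>Sym. norm (\<eta> - \<gamma>) < r \<longrightarrow>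
        norm (G t x y z \<eta> - G t x y z \<gamma> - A \<bullet> (\<eta> - \<gamma>)) \<le> e * norm (\<eta> - \<gamma>)"
      using A diff by auto
  qed
  with \<open>A \<in> Sym\<close> show ?thesis
    by (auto simp: frob_eq_inner)
qed

lemma Sym_line_deriv:
  assumes "(f has_derivative (\<lambda>\<eta>. A ::\<^sub>F \<eta>)) (at \<gamma> within Sym)" "\<gamma> \<in> Sym" "\<eta> \<in> Sym"
  shows "((\<lambda>s. f (\<gamma> + s *\<^sub>R \<eta>)) has_field_derivative (A \<bullet> \<eta>)) (at 0)"
proof -
  have "((\<lambda>s. \<gamma> + s *\<^sub>R \<eta>) has_derivative (\<lambda>s. s *\<^sub>R \<eta>)) (at 0)"
    by (auto intro!: derivative_eq_intros)
  moreover have "(\<lambda>s. \<gamma> + s *\<^sub>R \<eta>) ` UNIV \<subseteq> Sym"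
    using assms(2,3) by (auto simp: Sym_def transpose_def vec_eq_iff)
  then have "(f has_derivative (\<lambda>\<eta>. A ::\<^sub>F \<eta>)) (at (\<gamma> + 0 *\<^sub>R \<eta>) within (\<lambda>s. \<gamma> + s *\<^sub>R \<eta>) ` UNIV)"
    using has_derivative_subset[OF assms(1)] by simp
  ultimately have "((\<lambda>s. f (\<gamma> + s *\<^sub>R \<eta>)) has_derivative (\<lambda>s. A ::\<^sub>F (s *\<^sub>R \<eta>))) (at 0)"
    by (auto dest: diff_chain_within simp: o_def)
  then show ?thesis
    unfolding has_field_derivative_def
    by (rule has_derivative_eq_rhs) (auto simp: frob_eq_inner fun_eq_iff)
qed

lemma G_gamma_props:
  assumes "G_differentiable T G" "t \<in> {0..T}" "\<gamma> \<in> Sym"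
  shows "G_gamma G t x y z \<gamma> \<in> Sym \<and>
    ((\<lambda>\<eta>. G t x y z \<eta>) has_derivative (\<lambda>\<eta>. G_gamma G t x y z \<gamma> ::\<^sub>F \<eta>)) (at \<gamma> within Sym)"
  unfolding G_gamma_def
proof (rule theI')
  let ?P = "\<lambda>A. A \<in> Sym \<and>
    ((\<lambda>\<eta>. G t x y z \<eta>) has_derivative (\<lambda>\<eta>. A ::\<^sub>F \<eta>)) (at \<gamma> within Sym)"
  have "A = B" if "?P A" "?P B" for A B
  proof -
    have "A - B \<in> Sym"
      using that by (simp add: Sym_def transpose_def vec_eq_iff)
    then have "A \<bullet> (A - B) = B \<bullet> (A - B)"
      using Sym_line_deriv[of "\<lambda>\<eta>. G t x y z \<eta>"] that assms(3) DERIV_unique by blast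
    then have "(A - B) \<bullet> (A - B) = 0"
      by (simp add: inner_diff_left)
    then show ?thesis by simp
  qed
  with G_gamma_exists[OF assms] show "\<exists>!A. ?P A" by blast
qed

lemma norm_G_gamma_le:
  assumes "G_differentiable T G" "t \<in> {0..T}" "\<gamma> \<in> Sym" "L > 0"
    and lip: "\<And>\<gamma>'. \<gamma>' \<in> Sym \<Longrightarrow> \<bar>G t x y z \<gamma>' - G t x y z \<gamma>\<bar> \<le> L * norm (\<gamma>' - \<gamma>)"
  shows "norm (G_gamma G t x y z \<gamma>) \<le> L"
proof -
  define A where "A = G_gamma G t x y z \<gamma>"
  have A: "A \<in> Sym" "((\<lambda>\<eta>. G t x y z \<eta>) has_derivative (\<lambda>\<eta>. A ::\<^sub>F \<eta>)) (at \<gamma> within Sym)"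
    using G_gamma_props[OF assms(1-3)] by (auto simp: A_def)
  have "((\<lambda>s. (G t x y z (\<gamma> + s *\<^sub>R A) - G t x y z \<gamma>) / s) \<longlongrightarrow> A \<bullet> A) (at 0)"
    using Sym_line_deriv[OF A(2) assms(3) A(1)] by (simp add: DERIV_def)
  moreover have "norm ((G t x y z (\<gamma> + s *\<^sub>R A) - G t x y z \<gamma>) / s) \<le> L * norm A" if "s \<noteq> 0" for s
  proof -
    have "\<gamma> + s *\<^sub>R A \<in> Sym"
      using A(1) assms(3) by (simp add: Sym_def transpose_def vec_eq_iff)
    from lip[OF this] that show ?thesis
      by (simp add: field_simps)
  qed
  then have "\<forall>\<^sub>F s in at 0. norm ((G t x y z (\<gamma> + s *\<^sub>R A) - G t x y z \<gamma>) / s) \<le> L * norm A"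
    by (auto simp: eventually_at_filter)
  ultimately have "norm (A \<bullet> A) \<le> L * norm A"
    by (rule Lim_norm_ubound[rotated]) simp
  then have "norm A * norm A \<le> L * norm A"
    by (simp add: dot_square_norm power2_eq_square)
  then show ?thesis
    using assms(4) by (cases "norm A = 0") (auto simp: A_def)
qed

lemma conj_diag_le:
  fixes R A :: "real^'n^'n"
  shows "(R ** A ** transpose R) $ i $ i \<le> norm A * (norm R)\<^sup>2"
proof -
  have "(R ** A ** transpose R) $ i $ i = R $ i \<bullet> (R $ i v* A)"
    by (simp add: matrix_matrix_mult_def transpose_def inner_vec_def vector_matrix_mult_def
        mult.commute)
  also have "\<dots> = (\<Sum>k\<in>UNIV. \<Sum>l\<in>UNIV. A $ l $ k * (R $ i $ k * R $ i $ l))"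
    by (simp add: inner_vec_def vector_matrix_mult_def sum_distrib_left algebra_simps)
  also have "\<dots> = A \<bullet> (\<chi> l. (R $ i $ l) *\<^sub>R R $ i)"
    by (subst sum.swap) (simp add: inner_vec_def algebra_simps)
  also have "\<dots> \<le> norm A * norm (\<chi> l. (R $ i $ l) *\<^sub>R R $ i)"
    by (rule norm_cauchy_schwarz)
  also have "norm (\<chi> l. (R $ i $ l) *\<^sub>R R $ i) = norm (R $ i) * norm (R $ i)"
    by (simp add: norm_vec_def[where x = "\<chi> l. (R $ i $ l) *\<^sub>R R $ i"]
        L2_set_left_distrib[symmetric]) (simp add: norm_vec_def)
  also have "norm A * \<dots> \<le> norm A * (norm R)\<^sup>2"
    unfolding power2_eq_square
    by (intro mult_left_mono mult_mono Finite_Cartesian_Product.norm_nth_le) auto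
  finally show ?thesis .
qed

lemma diag_part_le:
  assumes "\<And>i. M $ i $ i \<le> c"
  shows "diag_part M \<preceq> c *\<^sub>R mat 1"
  unfolding psd_le_def
proof
  fix v :: "real^'a"
  have "((c *\<^sub>R mat 1 - diag_part M) *v v) $ i = (c - M $ i $ i) * v $ i" for i
  proof -
    have "(c *\<^sub>R mat 1 - diag_part M) $ i $ j * v $ j
        = (if j = i then (c - M $ i $ i) * v $ i else 0)" for j
      by (auto simp: mat_def diag_part_def)
    then show ?thesis
      unfolding matrix_vector_mult_def by simp
  qed
  then have "v \<bullet> ((c *\<^sub>R mat 1 - diag_part M) *v v) = (\<Sum>i\<in>UNIV. (c - M $ i $ i) * (v $ i)\<^sup>2)"
    by (simp add: inner_vec_def power2_eq_square mult_ac)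
  also have "\<dots> \<ge> 0"
    using assms by (intro sum_nonneg) simp
  finally show "0 \<le> v \<bullet> ((c *\<^sub>R mat 1 - diag_part M) *v v)" .
qed

lemma alpha_high_const_lipschitz:
  fixes G :: "'n::finite nonlin"
  assumes G: "G_differentiable T G" and "L > 0"
    and lip: "\<And>t x y z \<gamma> \<gamma>'. t \<in> {0..T} \<Longrightarrow> \<gamma> \<in> Sym \<Longrightarrow> \<gamma>' \<in> Sym \<Longrightarrow>
               \<bar>G t x y z \<gamma>' - G t x y z \<gamma>\<bar> \<le> L * norm (\<gamma>' - \<gamma>)"
  shows "alpha_high_const T G L"
proof -
  have "alpha_high G \<sigma> t x \<le> ereal (L * (norm (matrix_inv (\<sigma> t x)))\<^sup>2)"
    if inv: "invertible (\<sigma> t x)" and t: "t \<in> {0..T}" for \<sigma> t and x :: "real^'n"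
  proof -
    define R where "R = matrix_inv (\<sigma> t x)"
    have "\<sigma> t x ** R = mat 1"
      using inv unfolding R_def invertible_def matrix_inv_def by (rule someI2_ex) simp
    then have "(\<sigma> t x ** R) $ i $ i = 1" for i
      by (simp add: mat_def)
    then have "R \<noteq> 0"
      by (auto simp: matrix_matrix_mult_def)
    then have pos: "L * (norm R)\<^sup>2 > 0" using \<open>L > 0\<close> by simp
    have "diag_part (Gt_gamma G \<sigma> t x y z \<gamma>) \<preceq> (L * (norm R)\<^sup>2) *\<^sub>R mat 1"
      if "\<gamma> \<in> Sym" for y z \<gamma>
    proof (rule diag_part_le)
      fix i
      have "norm (G_gamma G t x y z \<gamma>) \<le> L"
        using G t that \<open>L > 0\<close> lip[OF t that] by (rule norm_G_gamma_le)
      then have "norm (G_gamma G t x y z \<gamma>) * (norm R)\<^sup>2 \<le> L * (norm R)\<^sup>2"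
        by (rule mult_right_mono) simp
      with conj_diag_le show "Gt_gamma G \<sigma> t x y z \<gamma> $ i $ i \<le> L * (norm R)\<^sup>2"
        unfolding Gt_gamma_def R_def by (rule order_trans)
    qed
    with pos show ?thesis
      unfolding alpha_high_def R_def[symmetric] by (intro Inf_lower imageI) simp
  qed
  with \<open>L > 0\<close> show ?thesis
    unfolding alpha_high_const_def by blast
qed

end

theory Submission
  imports Defs
begin

text \<open>Monotonicity: along the segment from \<open>\<phi>\<close> to \<open>\<psi>\<close>, the derivative of the scheme is at least
  the expectation of \<open>(\<psi> - \<phi>)\<close> against the weight
  \<open>1 + h (G\<^sub>\<gamma> - a\<^sub>0/2) : K\<^sub>2(\<xi>)\<close>, up to an error \<open>h L (1 + |K\<^sub>1(\<xi>)|)\<close>. Using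
  \<open>D[G] \<le> (1 + \<theta>) G\<close> (for the conjugated \<open>G\<^sub>\<gamma>\<close>) and \<open>\<xi>\<^sub>i\<^sup>2 \<in> {0, 1/p}\<close>, the weight
  is at least \<open>1 - p + p d - 2 p d \<Lambda> / c\<^sub>p\<^sup>2 = \<lambda>\<^sub>p |\<sigma>\<^sup>-\<^sup>1| / sqrt p\<close> when \<open>\<alpha> = c\<^sub>p\<^sup>-\<^sup>2\<close>, which
  dominates the error of order \<open>sqrt h |\<sigma>\<^sup>-\<^sup>1| / sqrt p\<close> because \<open>\<lambda>\<^sub>p\<close> is bounded below.

  Existence: \<open>\<theta>\<close>, \<open>\<Lambda>\<close>, \<open>c\<^sub>p\<close> and \<open>\<lambda>\<^sub>p\<close> do not change when \<open>\<sigma>\<^sub>0\<close> is multiplied by a positive scalar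
  function \<open>k\<close>, while the lower bound \<open>\<alpha>\<close> is divided by \<open>k\<^sup>2\<close>; so \<open>k = c\<^sub>p sqrt \<alpha>\<close> normalises
  \<open>\<alpha>\<close> to \<open>c\<^sub>p\<^sup>-\<^sup>2\<close>. The constant choice \<open>p = \<epsilon>\<^sub>0 / (4 d C\<^sub>0)\<close> bounds \<open>\<lambda>\<^sup>*\<close> from below, and since
  \<open>\<lambda>\<^sub>p\<close> is at most a constant times \<open>sqrt p\<close>, any \<open>p\<close> with \<open>\<lambda>\<^sub>p \<ge> \<lambda>\<^sup>*/2\<close> is bounded away from \<open>0\<close>.\<close>

section \<open>Matrices\<close>

lemma matrix_inv_right_left:
  fixes A :: "real^'n^'n"
  assumes "invertible A"
  shows "A ** matrix_inv A = mat 1" "matrix_inv A ** A = mat 1"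
  using someI_ex[of "\<lambda>B. A ** B = mat 1 \<and> B ** A = mat 1"] assms
  by (auto simp: invertible_def matrix_inv_def)

lemma scaleR_matrix_mult:
  fixes A :: "real^'n^'m" and B :: "real^'k^'n"
  shows "(c *\<^sub>R A) ** B = c *\<^sub>R (A ** B)" "A ** (c *\<^sub>R B) = c *\<^sub>R (A ** B)"
  by (simp_all add: matrix_matrix_mult_def vec_eq_iff sum_distrib_left mult_ac)

lemma transpose_scaleR: "transpose (c *\<^sub>R A) = c *\<^sub>R transpose (A :: real^'n^'m)"
  by (simp add: transpose_def vec_eq_iff)

lemma matrix_inv_scaleR:
  fixes A :: "real^'n^'n"
  assumes "invertible A" "k \<noteq> 0"
  shows "invertible (k *\<^sub>R A)" "matrix_inv (k *\<^sub>R A) = (1 / k) *\<^sub>R matrix_inv A"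
proof -
  have 1: "(k *\<^sub>R A) ** ((1 / k) *\<^sub>R matrix_inv A) = mat 1"
    "((1 / k) *\<^sub>R matrix_inv A) ** (k *\<^sub>R A) = mat 1"
    using matrix_inv_right_left[OF assms(1)] assms(2) by (simp_all add: scaleR_matrix_mult)
  then show 2: "invertible (k *\<^sub>R A)"
    unfolding invertible_def by blast
  \<comment> \<open>\<open>matrix_inv\<close> is defined by choice, so it is identified with the
    candidate through uniqueness of inverses.\<close>
  have "matrix_inv (k *\<^sub>R A)
      = matrix_inv (k *\<^sub>R A) ** ((k *\<^sub>R A) ** ((1 / k) *\<^sub>R matrix_inv A))"
    by (simp only: 1 matrix_mul_rid)
  also have "\<dots> = (1 / k) *\<^sub>R matrix_inv A"
    by (simp only: matrix_mul_assoc matrix_inv_right_left[OF 2] matrix_mul_lid)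
  finally show "matrix_inv (k *\<^sub>R A) = (1 / k) *\<^sub>R matrix_inv A" .
qed

lemma norm_matrix_inv_pos:
  fixes A :: "real^'n^'n"
  assumes "invertible A"
  shows "norm (matrix_inv A) > 0"
proof -
  have "matrix_inv A \<noteq> 0"
  proof
    assume "matrix_inv A = 0"
    with matrix_inv_right_left(1)[OF assms] have "(0 :: real^'n^'n) = mat 1"
      by (simp add: matrix_matrix_mult_def zero_vec_def)
    then show False
      by (simp add: mat_def vec_eq_iff split: if_splits)
  qed
  then show ?thesis by simp
qed

lemma quadform_diag_part:
  "v \<bullet> (diag_part M *v v) = (\<Sum>i\<in>UNIV. M $ i $ i * (v $ i)\<^sup>2)"
proof -
  have "(diag_part M *v v) $ i = M $ i $ i * v $ i" for i
  proof -
    have "diag_part M $ i $ j * v $ j = (if j = i then M $ i $ i * v $ i else 0)" for j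
      by (auto simp: diag_part_def)
    then show ?thesis
      unfolding matrix_vector_mult_def by simp
  qed
  then show ?thesis
    by (simp add: inner_vec_def power2_eq_square mult_ac)
qed

text \<open>Test the quadratic form on a basis vector.\<close>

lemma psd_le_diag:
  assumes "A \<preceq> B"
  shows "A $ i $ i \<le> B $ i $ i"
proof -
  have "0 \<le> axis i 1 \<bullet> ((B - A) *v axis i 1)"
    using assms unfolding psd_le_def by blast
  then show ?thesis
    by (simp add: matrix_vector_mult_basis column_def inner_axis')
qed

lemma le_diag_partD: "c *\<^sub>R mat 1 \<preceq> diag_part M \<Longrightarrow> c \<le> M $ i $ i"
  and diag_part_leD: "diag_part M \<preceq> c *\<^sub>R mat 1 \<Longrightarrow> M $ i $ i \<le> c"
  using psd_le_diag[of "c *\<^sub>R mat 1" "diag_part M" i] psd_le_diag[of "diag_part M" "c *\<^sub>R mat 1" i]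
  by (simp_all add: mat_def diag_part_def)

lemma psd_le_scaleR_iff:
  assumes "c > 0"
  shows "c *\<^sub>R A \<preceq> c *\<^sub>R B \<longleftrightarrow> A \<preceq> B"
  using assms
  by (simp add: psd_le_def scaleR_diff_right[symmetric] scaleR_matrix_vector_assoc[symmetric]
      zero_le_mult_iff)

lemma diag_part_scaleR: "diag_part (c *\<^sub>R A) = c *\<^sub>R diag_part A"
  by (simp add: diag_part_def vec_eq_iff)

text \<open>Cyclicity of the trace. It moves the two factors \<open>matrix_inv S\<close> of
  \<open>K2\<close> onto \<open>G_gamma\<close>, where they form \<open>Gt_gamma\<close>.\<close>

lemma inner_conj_matrix:
  fixes A M R :: "real^'n^'n"
  shows "A \<bullet> (transpose R ** M ** R) = (R ** A ** transpose R) \<bullet> M"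
proof -
  have "trace (A ** transpose R ** (transpose M ** R))
      = trace (R ** (A ** transpose R ** transpose M))"
    by (subst (2) trace_mul_sym) (simp add: matrix_mul_assoc)
  then show ?thesis
    by (simp add: frob_eq_inner[symmetric] frob_def matrix_transpose_mul transpose_transpose
        matrix_mul_assoc)
qed

lemma inner_outer_sq: "M \<bullet> outer_sq v = v \<bullet> (M *v v)"
  by (simp add: inner_vec_def outer_sq_def matrix_vector_mult_def sum_distrib_left mult_ac)

lemma inner_diag_part: "M \<bullet> diag_part A = (\<Sum>i\<in>UNIV. M $ i $ i * A $ i $ i)"
  by (simp add: inner_vec_def diag_part_def if_distrib cong: if_cong)

lemma inner_mat_1: "M \<bullet> mat 1 = (\<Sum>i\<in>UNIV. M $ i $ i)" for M :: "real^'n^'n"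
  by (simp add: inner_vec_def mat_def if_distrib cong: if_cong)

text \<open>Keeps the argument \<open>D2\<close> of the nonlinearity inside \<open>Sym\<close>, the
  only matrices on which \<open>G\<close> is constrained.\<close>

lemma K2_Sym: "K2 h S p \<xi> \<in> Sym"
proof -
  define M where "M = (1 - p) *\<^sub>R outer_sq \<xi> - (1 - 3 * p) *\<^sub>R diag_part (outer_sq \<xi>)
    - (2 * p) *\<^sub>R mat 1"
  have "transpose M = M"
    by (simp add: M_def transpose_def outer_sq_def diag_part_def mat_def vec_eq_iff)
  then show ?thesis
    unfolding K2_def M_def[symmetric] Sym_def
    by (simp add: transpose_scaleR matrix_transpose_mul transpose_transpose matrix_mul_assoc)
qed

lemma Sym_add: "A \<in> Sym \<Longrightarrow> B \<in> Sym \<Longrightarrow> A + B \<in> Sym"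
  by (simp add: Sym_def transpose_def vec_eq_iff)

lemma Sym_scaleR: "A \<in> Sym \<Longrightarrow> c *\<^sub>R A \<in> Sym"
  by (simp add: Sym_def transpose_def vec_eq_iff)

lemma Sym_sum: "(\<And>i. i \<in> I \<Longrightarrow> f i \<in> Sym) \<Longrightarrow> sum f I \<in> Sym"
proof (induction I rule: infinite_finite_induct)
  case (insert i I)
  then show ?case by (simp add: Sym_add)
qed (simp_all add: Sym_def transpose_def vec_eq_iff)

section \<open>Pairing of the second-order kernel with the derivative of the nonlinearity\<close>

text \<open>The factor \<open>(1 - p) * h\<close> removes the denominator of \<open>K2\<close>.
  Conjugation by \<open>matrix_inv S\<close> replaces \<open>A\<close> by \<open>B\<close> and
  \<open>S ** transpose S\<close> by the identity, which leaves a quadratic polynomial in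
  \<xi>.\<close>

lemma inner_K2_eq:
  fixes S A :: "real^'n::finite^'n"
  assumes "invertible S" "h > 0" "p < 1"
  defines "B \<equiv> matrix_inv S ** A ** transpose (matrix_inv S)"
  shows "(1 - p) * (h * ((A - (1/2) *\<^sub>R (S ** transpose S)) \<bullet> K2 h S p \<xi>))
    = (1 - p) * (\<xi> \<bullet> (B *v \<xi>)) - (1 - 3 * p) * (\<Sum>i\<in>UNIV. B $ i $ i * (\<xi> $ i)\<^sup>2)
      - 2 * p * (\<Sum>i\<in>UNIV. B $ i $ i) - p * (\<Sum>i\<in>UNIV. (\<xi> $ i)\<^sup>2) + p * real CARD('n)"
proof -
  define R where "R = matrix_inv S"
  define M where "M = (1 - p) *\<^sub>R outer_sq \<xi> - (1 - 3 * p) *\<^sub>R diag_part (outer_sq \<xi>)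
    - (2 * p) *\<^sub>R mat 1"
  have RS: "R ** S = mat 1"
    using matrix_inv_right_left[OF assms(1)] by (simp add: R_def)
  have "R ** (S ** transpose S) ** transpose R = (R ** S) ** transpose (R ** S)"
    by (simp add: matrix_transpose_mul matrix_mul_assoc)
  then have one: "R ** (S ** transpose S) ** transpose R = mat 1"
    by (simp add: RS transpose_mat)
  have "(1 - p) * (h * ((A - (1/2) *\<^sub>R (S ** transpose S)) \<bullet> K2 h S p \<xi>))
      = (A - (1/2) *\<^sub>R (S ** transpose S)) \<bullet> (transpose R ** M ** R)"
    using assms(2,3) by (simp add: K2_def R_def M_def)
  also have "\<dots> = A \<bullet> (transpose R ** M ** R)
      - (1/2) * ((S ** transpose S) \<bullet> (transpose R ** M ** R))"
    by (simp add: inner_diff_left)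
  also have "\<dots> = B \<bullet> M - (1/2) * (mat 1 \<bullet> M)"
    by (simp only: inner_conj_matrix one) (simp add: B_def R_def)
  also have "B \<bullet> M = (1 - p) * (\<xi> \<bullet> (B *v \<xi>)) - (1 - 3 * p) * (\<Sum>i\<in>UNIV. B $ i $ i * (\<xi> $ i)\<^sup>2)
      - 2 * p * (\<Sum>i\<in>UNIV. B $ i $ i)"
    by (simp add: M_def inner_diff_right inner_outer_sq inner_diag_part inner_mat_1)
      (simp add: outer_sq_def power2_eq_square)
  also have "mat 1 \<bullet> M = 2 * p * (\<Sum>i\<in>UNIV. (\<xi> $ i)\<^sup>2) - 2 * p * real CARD('n)"
    by (simp add: M_def inner_diff_right inner_outer_sq inner_diag_part inner_mat_1)
      (simp add: outer_sq_def power2_eq_square mat_def inner_vec_def algebra_simps)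
  finally show ?thesis by (simp add: algebra_simps)
qed

text \<open>In use, \<open>B\<close> is a value of \<open>Gt_gamma\<close>, \<open>a\<close> and
  \<open>b\<close> bound its diagonal, and \<open>q\<close> is \<open>alpha_p\<close>. By
  \<open>dom\<close> the full quadratic form is replaced by its diagonal part, after which
  everything splits into coordinates. Each coordinate contributes at least
  \<open>- 2 * p * b\<close>, whether that component of \<xi> vanishes or not; \<open>ab\<close> is
  the relation that makes both cases end in the same bound.\<close>

lemma K2_weight_bound:
  fixes B :: "real^'n::finite^'n" and \<theta> a b p q :: real
  assumes p: "0 < p" "p \<le> 1/3" and \<theta>: "\<theta> \<ge> 0"
    and q: "q = (p * (2 + 3 * \<theta>) - \<theta>) / (p * (1 + \<theta>))" "2 * p \<le> q"
    and B: "\<And>i. a \<le> B $ i $ i" "\<And>i. B $ i $ i \<le> b"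
    and ab: "a * (q - 2 * p) + 2 * p * b = 1"
    and dom: "(\<Sum>i\<in>UNIV. B $ i $ i * (\<xi> $ i)\<^sup>2) \<le> (1 + \<theta>) * (\<xi> \<bullet> (B *v \<xi>))"
    and \<xi>: "\<And>i. \<xi> $ i = 0 \<or> p * (\<xi> $ i)\<^sup>2 = 1"
  shows "1 - p + p * real CARD('n) - 2 * p * real CARD('n) * b \<le>
    1 - p + ((1 - p) * (\<xi> \<bullet> (B *v \<xi>)) - (1 - 3 * p) * (\<Sum>i\<in>UNIV. B $ i $ i * (\<xi> $ i)\<^sup>2)
      - 2 * p * (\<Sum>i\<in>UNIV. B $ i $ i) - p * (\<Sum>i\<in>UNIV. (\<xi> $ i)\<^sup>2) + p * real CARD('n))"
proof -
  define s where "s = (\<Sum>i\<in>UNIV. B $ i $ i * (\<xi> $ i)\<^sup>2)"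
  have "(1 - p) * s \<le> (1 - p) * ((1 + \<theta>) * (\<xi> \<bullet> (B *v \<xi>)))"
    using dom p by (intro mult_left_mono) (auto simp: s_def)
  then have Q: "(1 - p) * s / (1 + \<theta>) \<le> (1 - p) * (\<xi> \<bullet> (B *v \<xi>))"
    using \<theta> by (simp add: field_simps)
  \<comment> \<open>This explains the formula for \<open>alpha_p\<close>: (1 - p) - (1 - 3p)(1 +
    \<theta>) = p(2 + 3\<theta>) - \<theta>.\<close>
  have coeff: "(1 - p) * s / (1 + \<theta>) - (1 - 3 * p) * s = p * q * s"
  proof -
    have "p * q = (p * (2 + 3 * \<theta>) - \<theta>) / (1 + \<theta>)"
      using p by (simp add: q(1))
    show ?thesis
      unfolding \<open>p * q = _\<close> using \<theta> by (simp add: field_simps)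
  qed
  have term_bound: "- (2 * p * b) \<le>
      p * q * (B $ i $ i * (\<xi> $ i)\<^sup>2) - 2 * p * B $ i $ i - p * (\<xi> $ i)\<^sup>2" for i
    using \<xi>[of i]
  proof
    assume "\<xi> $ i = 0"
    then show ?thesis using B(2)[of i] p by simp
  next
    assume 1: "p * (\<xi> $ i)\<^sup>2 = 1"
    have "p * q * (B $ i $ i * (\<xi> $ i)\<^sup>2) = q * B $ i $ i * (p * (\<xi> $ i)\<^sup>2)"
      by simp
    then have 2: "p * q * (B $ i $ i * (\<xi> $ i)\<^sup>2) = q * B $ i $ i"
      by (simp only: 1)
    have "a * (q - 2 * p) \<le> B $ i $ i * (q - 2 * p)"
      using B(1)[of i] q(2) by (intro mult_right_mono) auto
    then show ?thesis unfolding 1 2 using ab by (simp add: algebra_simps)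
  qed
  have "(\<Sum>i\<in>(UNIV :: 'n set). - (2 * p * b)) \<le>
      (\<Sum>i\<in>UNIV. p * q * (B $ i $ i * (\<xi> $ i)\<^sup>2) - 2 * p * B $ i $ i - p * (\<xi> $ i)\<^sup>2)"
    by (rule sum_mono) (rule term_bound)
  also have "\<dots> = p * q * s - 2 * p * (\<Sum>i\<in>UNIV. B $ i $ i) - p * (\<Sum>i\<in>UNIV. (\<xi> $ i)\<^sup>2)"
    by (simp add: s_def sum_subtractf sum_distrib_left)
  finally show ?thesis
    using Q coeff unfolding s_def[symmetric] by (simp add: algebra_simps)
qed


section \<open>The increment law\<close>

lemma set_xi_comp_pmf:
  assumes "0 < p" "p < 1"
  shows "set_pmf (xi_comp_pmf p) \<subseteq> {1 / sqrt p, - 1 / sqrt p, 0}"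
proof -
  have "pmf_of_list_wf [(1 / sqrt p, p / 2), (- 1 / sqrt p, p / 2), (0, 1 - p)]"
    using assms by (intro pmf_of_list_wfI) auto
  from set_pmf_of_list[OF this] show ?thesis
    by (simp add: xi_comp_pmf_def)
qed

lemma xi_pmf_component:
  assumes "0 < p" "p < 1" "\<xi> \<in> set_pmf (xi_pmf p :: (real^'n::finite) pmf)"
  shows "\<xi> $ i = 0 \<or> p * (\<xi> $ i)\<^sup>2 = 1"
proof -
  have "\<xi> $ i \<in> set_pmf (xi_comp_pmf p)"
    using assms(3) set_Pi_pmf_subset'[of "UNIV :: 'n set" 0 "\<lambda>_. xi_comp_pmf p"]
    by (auto simp: xi_pmf_def PiE_dflt_def)
  then show ?thesis
    using set_xi_comp_pmf[OF assms(1,2)] assms(1) by (auto simp: power_divide)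
qed

text \<open>Turns the expectations in \<open>D0\<close>, \<open>D1\<close> and \<open>D2\<close>
  into finite sums, so that no integrability question arises.\<close>

lemma finite_set_xi_pmf:
  assumes "0 < p" "p < 1"
  shows "finite (set_pmf (xi_pmf p :: (real^'n::finite) pmf))"
proof -
  have "finite (set_pmf (xi_comp_pmf p))"
    using set_xi_comp_pmf[OF assms] by (rule finite_subset) simp
  then show ?thesis
    by (simp add: xi_pmf_def set_Pi_pmf finite_PiE_dflt)
qed

lemma norm_xi_le:
  fixes \<xi> :: "real^'n::finite"
  assumes "0 < p" "\<And>i. \<xi> $ i = 0 \<or> p * (\<xi> $ i)\<^sup>2 = 1"
  shows "norm \<xi> \<le> sqrt (real CARD('n)) / sqrt p"
proof -
  have "(\<xi> $ i)\<^sup>2 \<le> 1 / p" for i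
    using assms(2)[of i] assms(1) by (auto simp: field_simps)
  then have "(\<Sum>i\<in>UNIV. (\<xi> $ i)\<^sup>2) \<le> (\<Sum>i\<in>(UNIV :: 'n set). 1 / p)"
    by (intro sum_mono)
  then have "norm \<xi> \<le> sqrt (real CARD('n) / p)"
    unfolding norm_vec_def L2_set_def by (simp add: power2_abs)
  then show ?thesis by (simp add: real_sqrt_divide)
qed

text \<open>Cauchy-Schwarz row by row; the norm of a matrix is here the Frobenius norm.\<close>

lemma norm_matrix_vector_mult_le:
  fixes A :: "real^'n^'m"
  shows "norm (A *v v) \<le> norm A * norm v"
proof -
  have "\<bar>(A *v v) $ i\<bar> \<le> norm (A $ i) * norm v" for i
    by (simp add: matrix_vector_mul_component Cauchy_Schwarz_ineq2)
  then have "norm (A *v v) \<le> L2_set (\<lambda>i. norm (A $ i) * norm v) UNIV"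
    unfolding norm_vec_def[of "A *v v"] by (intro L2_set_mono) auto
  also have "\<dots> = norm A * norm v"
    by (simp add: L2_set_left_distrib[symmetric] norm_vec_def[of A])
  finally show ?thesis .
qed

lemma norm_transpose: "norm (transpose A) = norm A" for A :: "real^'n^'m"
proof -
  have "transpose A \<bullet> transpose A = A \<bullet> A"
    by (simp add: inner_vec_def transpose_def) (rule sum.swap)
  then show ?thesis
    by (simp add: norm_eq_sqrt_inner)
qed

text \<open>The factor \<open>sqrt h\<close> cancels the singularity of \<open>K1\<close>, so the
  bound is uniform in \<open>h\<close>.\<close>

lemma norm_K1_le:
  fixes \<xi> :: "real^'n::finite"
  assumes "h > 0" "0 < p" "\<And>i. \<xi> $ i = 0 \<or> p * (\<xi> $ i)\<^sup>2 = 1"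
  shows "sqrt h * norm (K1 h S \<xi>) \<le> norm (matrix_inv S) * (sqrt (real CARD('n)) / sqrt p)"
proof -
  have "sqrt h * norm (K1 h S \<xi>) = norm (transpose (matrix_inv S) *v \<xi>)"
    using assms(1) by (simp add: K1_def)
  also have "\<dots> \<le> norm (matrix_inv S) * norm \<xi>"
    using norm_matrix_vector_mult_le[of "transpose (matrix_inv S)" \<xi>] by (simp add: norm_transpose)
  also have "\<dots> \<le> norm (matrix_inv S) * (sqrt (real CARD('n)) / sqrt p)"
    using norm_xi_le[OF assms(2,3)] by (rule mult_left_mono) simp
  finally show ?thesis .
qed


section \<open>The quantities associated with the volatility field\<close>

lemma alpha_low_le_diag:
  assumes "\<gamma> \<in> Sym"
  shows "alpha_low G \<sigma> t x \<le> ereal (Gt_gamma G \<sigma> t x y z \<gamma> $ i $ i)"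
  unfolding alpha_low_def using assms
  by (intro Sup_least) (force dest: le_diag_partD[where i = i])

lemma diag_le_alpha_high:
  assumes "\<gamma> \<in> Sym"
  shows "ereal (Gt_gamma G \<sigma> t x y z \<gamma> $ i $ i) \<le> alpha_high G \<sigma> t x"
  unfolding alpha_high_def using assms
  by (intro Inf_greatest) (force dest: diag_part_leD[where i = i])

lemma zero_Sym: "0 \<in> Sym"
  by (simp add: Sym_def transpose_def vec_eq_iff)

text \<open>Both sides are compared with one diagonal entry of \<open>Gt_gamma\<close> at \<gamma> =
  0.\<close>

lemma alpha_low_le_high: "alpha_low G \<sigma> t x \<le> alpha_high G \<sigma> t x"
  using order_trans[OF alpha_low_le_diag[OF zero_Sym] diag_le_alpha_high[OF zero_Sym]] .

lemma alpha_high_nonneg: "0 \<le> alpha_high G \<sigma> t x"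
  unfolding alpha_high_def by (intro Inf_greatest) auto

lemma theta_nonneg: "0 \<le> theta G \<sigma> t x"
  unfolding theta_def by (intro Inf_greatest) auto

lemma alpha_low_real_nonneg: "0 \<le> real_of_ereal (alpha_low G \<sigma> t x)"
proof (cases "\<exists>\<alpha>>0. \<forall>y z. \<forall>\<gamma>\<in>Sym. \<alpha> *\<^sub>R mat 1 \<preceq> diag_part (Gt_gamma G \<sigma> t x y z \<gamma>)")
  case True
  then obtain \<alpha> where "\<alpha> > 0"
    "\<forall>y z. \<forall>\<gamma>\<in>Sym. \<alpha> *\<^sub>R mat 1 \<preceq> diag_part (Gt_gamma G \<sigma> t x y z \<gamma>)" by blast
  then have "ereal \<alpha> \<le> alpha_low G \<sigma> t x"
    unfolding alpha_low_def by (intro Sup_upper) auto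
  moreover have "0 \<le> ereal \<alpha>" using \<open>\<alpha> > 0\<close> by simp
  ultimately have "0 \<le> alpha_low G \<sigma> t x" by (rule order_trans[rotated])
  then show ?thesis by (rule real_of_ereal_pos)
next
  case False
  \<comment> \<open>Without an admissible \<alpha> the supremum is -\<infinity>, which
    \<open>real_of_ereal\<close> sends to 0.\<close>
  then have "{\<alpha>. \<alpha> > 0 \<and>
     (\<forall>y z. \<forall>\<gamma>\<in>Sym. \<alpha> *\<^sub>R mat 1 \<preceq> diag_part (Gt_gamma G \<sigma> t x y z \<gamma>))} = {}"
    by blast
  show ?thesis
    unfolding alpha_low_def \<open>_ = {}\<close> by (simp add: bot_ereal_def)
qed

lemma Lam_nonneg: "0 \<le> Lam G \<sigma> t x"
  unfolding Lam_def
  by (intro divide_nonneg_nonneg alpha_low_real_nonneg real_of_ereal_pos alpha_high_nonneg)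

text \<open>For fixed \<open>v\<close>, each admissible \<open>r\<close> gives
  \<open>D \<le> (1 + r) * Q\<close>, and this survives the passage to the infimum. If
  \<open>Q > 0\<close>, then \<open>D / Q - 1\<close> is a lower bound of the admissible set; if
  \<open>Q \<le> 0\<close>, lowering \<open>r\<close> to the infimum can only enlarge the right-hand
  side.\<close>

lemma theta_quadform:
  fixes G :: "'n::finite nonlin" and y :: real and z :: "real^'n"
  assumes "theta G \<sigma> t x = ereal \<theta>" "\<gamma> \<in> Sym"
  defines "B \<equiv> Gt_gamma G \<sigma> t x y z \<gamma>"
  shows "(\<Sum>i\<in>UNIV. B $ i $ i * (v $ i)\<^sup>2) \<le> (1 + \<theta>) * (v \<bullet> (B *v v))"
proof -
  define D where "D = (\<Sum>i\<in>UNIV. B $ i $ i * (v $ i)\<^sup>2)"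
  define Q where "Q = v \<bullet> (B *v v)"
  define X where "X = {\<theta>. \<theta> \<ge> 0 \<and> (\<forall>y z. \<forall>\<gamma>\<in>Sym. diag_part (Gt_gamma G \<sigma> t x y z \<gamma>)
                      \<preceq> (1 + \<theta>) *\<^sub>R Gt_gamma G \<sigma> t x y z \<gamma>)}"
  have inf: "Inf (ereal ` X) = ereal \<theta>"
    using assms(1) unfolding theta_def X_def .
  have le: "D \<le> (1 + r) * Q" if "r \<in> X" for r
  proof -
    have "diag_part B \<preceq> (1 + r) *\<^sub>R B"
      using that assms(2) by (auto simp: X_def B_def)
    then have "0 \<le> v \<bullet> (((1 + r) *\<^sub>R B - diag_part B) *v v)"
      unfolding psd_le_def by blast
    then show ?thesis
      by (simp add: D_def Q_def matrix_vector_mult_diff_rdistrib inner_diff_right quadform_diag_part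
          scaleR_matrix_vector_assoc[symmetric])
  qed
  \<comment> \<open>The infimum of the empty set would be \<infinity>, but it is finite
    here.\<close>
  have "X \<noteq> {}"
    using inf by (auto simp: top_ereal_def)
  then obtain r where r: "r \<in> X" by blast
  have "D \<le> (1 + \<theta>) * Q"
  proof (cases "Q > 0")
    case True
    have "ereal (D / Q - 1) \<le> Inf (ereal ` X)"
      using le True by (intro Inf_greatest) (auto simp: field_simps)
    then show ?thesis
      using True by (simp add: inf field_simps)
  next
    case False
    have "ereal \<theta> \<le> ereal r"
      using Inf_lower[of "ereal r" "ereal ` X"] r by (auto simp: inf)
    then have "(1 + r) * Q \<le> (1 + \<theta>) * Q"
      using False by (intro mult_right_mono_neg) auto
    with le[OF r] show ?thesis by linarith
  qed
  then show ?thesis by (simp add: D_def Q_def)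
qed

section \<open>Elementary bounds for alpha_p and c_p\<close>

text \<open>The lower end of \<open>p_range\<close> says \<theta> \<le> 2p(1 + \<theta>); multiplied
  by 1 - p this is exactly \<open>alpha_p\<close> \<ge> 2p. The bound by 2 amounts to p\<theta>
  \<le> \<theta>.\<close>

lemma alpha_p_bounds:
  assumes "p \<in> p_range G \<sigma> t x"
  shows "0 < p" "p \<le> 1/3" "2 * p \<le> alpha_p G \<sigma> t x p" "alpha_p G \<sigma> t x p \<le> 2"
proof -
  define \<theta> where "\<theta> = real_of_ereal (theta G \<sigma> t x)"
  have \<theta>: "\<theta> \<ge> 0"
    unfolding \<theta>_def by (intro real_of_ereal_pos theta_nonneg)
  show p: "0 < p" "p \<le> 1/3"
    using assms by (auto simp: p_range_def Let_def)
  have ap: "alpha_p G \<sigma> t x p = (p * (2 + 3 * \<theta>) - \<theta>) / (p * (1 + \<theta>))"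
    by (simp add: alpha_p_def \<theta>_def Let_def)
  have "\<theta> / (2 * (1 + \<theta>)) \<le> p"
    using assms by (simp add: p_range_def \<theta>_def Let_def)
  then have "\<theta> \<le> p * (2 * (1 + \<theta>))"
    using \<theta> by (simp add: divide_le_eq)
  then have "(1 - p) * \<theta> \<le> (1 - p) * (p * (2 * (1 + \<theta>)))"
    using p by (intro mult_left_mono) auto
  then have "2 * p * (p * (1 + \<theta>)) \<le> p * (2 + 3 * \<theta>) - \<theta>"
    by (simp add: algebra_simps)
  then show "2 * p \<le> alpha_p G \<sigma> t x p"
    using p \<theta> by (simp add: ap le_divide_eq)
  have "p * \<theta> \<le> 1 * \<theta>"
    using p \<theta> by (intro mult_right_mono) auto
  then have "p * (2 + 3 * \<theta>) - \<theta> \<le> 2 * (p * (1 + \<theta>))"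
    by (simp add: algebra_simps)
  then show "alpha_p G \<sigma> t x p \<le> 2"
    using p \<theta> by (simp add: ap divide_le_eq)
qed

text \<open>The radicand is nonnegative because \<open>alpha_p\<close> \<ge> 2p and
  \<open>Lam\<close> \<ge> 0; the last bound uses 2p \<le> 1 and \<open>alpha_p\<close> \<le>
  2.\<close>

lemma c_p_bounds:
  assumes "p \<in> p_range G \<sigma> t x"
  shows "0 \<le> c_p G \<sigma> t x p"
    and "(c_p G \<sigma> t x p)\<^sup>2 = 2 * p * Lam G \<sigma> t x + alpha_p G \<sigma> t x p - 2 * p"
    and "(c_p G \<sigma> t x p)\<^sup>2 \<le> Lam G \<sigma> t x + 2"
proof -
  note p = alpha_p_bounds[OF assms]
  have pos: "0 \<le> 2 * p * Lam G \<sigma> t x + alpha_p G \<sigma> t x p - 2 * p"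
    using p Lam_nonneg[of G \<sigma> t x] by (simp add: add_increasing)
  then show "0 \<le> c_p G \<sigma> t x p"
    by (simp add: c_p_def)
  show sq: "(c_p G \<sigma> t x p)\<^sup>2 = 2 * p * Lam G \<sigma> t x + alpha_p G \<sigma> t x p - 2 * p"
    using pos by (simp add: c_p_def)
  have "2 * p * Lam G \<sigma> t x \<le> 1 * Lam G \<sigma> t x"
    using p Lam_nonneg by (intro mult_right_mono) auto
  then show "(c_p G \<sigma> t x p)\<^sup>2 \<le> Lam G \<sigma> t x + 2"
    using p sq by simp
qed

section \<open>Monotonicity of the scheme\<close>

text \<open>A derivative within \<open>S\<close> suffices because the whole line stays in
  \<open>S\<close>. In use, \<open>S\<close> restricts the matrix component to
  \<open>Sym\<close>.\<close>

lemma has_derivative_along_line: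
  assumes "(f has_derivative D) (at (p + r *\<^sub>R w) within S)" "\<And>s. p + s *\<^sub>R w \<in> S"
  shows "((\<lambda>s. f (p + s *\<^sub>R w)) has_field_derivative D w) (at r)"
proof -
  have "((\<lambda>s. p + s *\<^sub>R w) has_derivative (\<lambda>s. s *\<^sub>R w)) (at r)"
    by (auto intro!: derivative_eq_intros)
  moreover have "(f has_derivative D) (at (p + r *\<^sub>R w) within (\<lambda>s. p + s *\<^sub>R w) ` UNIV)"
    using assms(2) by (intro has_derivative_subset[OF assms(1)]) auto
  ultimately have "((\<lambda>s. f (p + s *\<^sub>R w)) has_derivative (\<lambda>s. D (s *\<^sub>R w))) (at r)"
    by (auto dest: diff_chain_within simp: o_def)
  then show ?thesis
    unfolding has_field_derivative_def
    by (rule has_derivative_eq_rhs)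
      (auto simp: fun_eq_iff linear_cmul[OF has_derivative_linear[OF assms(1)]])
qed

lemma abs_derivative_le_lipschitz:
  assumes "(f has_derivative D) (at p within S)" "\<And>s. p + s *\<^sub>R w \<in> S"
    and lip: "\<And>s. \<bar>f (p + s *\<^sub>R w) - f p\<bar> \<le> C * \<bar>s\<bar>"
  shows "\<bar>D w\<bar> \<le> (C :: real)"
proof -
  have "((\<lambda>s. f (p + s *\<^sub>R w)) has_field_derivative D w) (at 0)"
    using assms(1,2) by (intro has_derivative_along_line) auto
  then have "((\<lambda>s. (f (p + s *\<^sub>R w) - f p) / s) \<longlongrightarrow> D w) (at 0)"
    by (simp add: DERIV_def)
  moreover have "\<forall>\<^sub>F s in at 0. norm ((f (p + s *\<^sub>R w) - f p) / s) \<le> C"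
    using lip by (auto simp: eventually_at_filter divide_le_eq)
  ultimately have "norm (D w) \<le> C"
    by (rule Lim_norm_ubound[rotated]) simp
  then show ?thesis by simp
qed

text \<open>Along the segment from \<open>(y, z, \<gamma>)\<close> to
  \<open>(y + u, z + w, \<gamma> + \<delta>)\<close> the scheme becomes a function of one variable
  whose derivative is nonnegative. The directions \<open>u\<close> and \<open>w\<close> are
  estimated by the Lipschitz constant only, whereas the direction \<delta> is kept exactly through
  \<open>G_gamma\<close>: it is of size 1 / h and must be weighed against the leading term.\<close>

lemma F_nl_increment:
  fixes G :: "'n::finite nonlin"
  assumes G: "G_differentiable T G" and t: "t \<in> {0..T}"
    and lip: "L-lipschitz_on (UNIV \<times> UNIV \<times> UNIV \<times> Sym) (\<lambda>(x, y, z, \<gamma>). G t x y z \<gamma>)"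
    and h: "h \<ge> 0" and Sym: "\<gamma> \<in> Sym" "\<delta> \<in> Sym"
    and pos: "\<And>y z \<gamma>. \<gamma> \<in> Sym \<Longrightarrow> 0 \<le> u - h * L * (\<bar>u\<bar> + norm w)
      + h * ((G_gamma G t x y z \<gamma> - (1/2) *\<^sub>R (\<sigma> t x ** transpose (\<sigma> t x))) \<bullet> \<delta>)"
  shows "y + h * F_nl G \<sigma> t x y z \<gamma>
    \<le> (y + u) + h * F_nl G \<sigma> t x (y + u) (z + w) (\<gamma> + \<delta>)"
proof -
  define A where "A = \<sigma> t x ** transpose (\<sigma> t x)"
  define g where "g = (\<lambda>(y, z, \<gamma>). G t x y z \<gamma>)"
  define P where "P = (y, z, \<gamma>)"
  define W where "W = (u, w, \<delta>)"
  let ?S = "UNIV \<times> UNIV \<times> (Sym :: (real^'n^'n) set)"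
  define f where "f = (\<lambda>s. (y + s * u) + h * (g (P + s *\<^sub>R W) - (1/2) * (A \<bullet> (\<gamma> + s *\<^sub>R \<delta>))))"
  have mem: "\<gamma> + s *\<^sub>R \<delta> \<in> Sym" for s
    using Sym by (intro Sym_add Sym_scaleR)
  have line: "P + s *\<^sub>R W \<in> ?S" for s
    using mem by (simp add: P_def W_def)
  have "\<exists>c. (f has_field_derivative c) (at s) \<and> 0 \<le> c" for s
  proof -
    let ?y = "y + s * u" and ?z = "z + s *\<^sub>R w" and ?\<gamma> = "\<gamma> + s *\<^sub>R \<delta>"
    have Ps: "P + s *\<^sub>R W = (?y, ?z, ?\<gamma>)"
      by (simp add: P_def W_def)
    obtain D where D: "(g has_derivative D) (at (?y, ?z, ?\<gamma>) within ?S)"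
      using G t mem unfolding G_differentiable_def differentiable_def g_def by blast
    have lin: "linear D" using D by (rule has_derivative_linear)
    have "((\<lambda>s. g (P + s *\<^sub>R W)) has_field_derivative D W) (at s)"
      using D line by (intro has_derivative_along_line) (simp_all add: Ps)
    then have der: "(f has_field_derivative u + h * (D W - (1/2) * (A \<bullet> \<delta>))) (at s)"
      unfolding f_def by (auto intro!: derivative_eq_intros simp: inner_add_right)
    have "W = (u, w, 0) + (0, 0, \<delta>)" by (simp add: W_def)
    then have DW: "D W = D (u, w, 0) + D (0, 0, \<delta>)"
      by (simp only: linear_add[OF lin])
    \<comment> \<open>The joint derivative in (y, z, \<gamma>) and the partial one defining
      \<open>G_gamma\<close> agree on \<delta>, as both are the derivative of the same function of
      one variable.\<close>
    have "D (0, 0, \<delta>) = G_gamma G t x ?y ?z ?\<gamma> \<bullet> \<delta>"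
    proof -
      have "((\<lambda>r. g ((?y, ?z, ?\<gamma>) + r *\<^sub>R (0, 0, \<delta>))) has_field_derivative D (0, 0, \<delta>)) (at 0)"
        using D Sym mem by (intro has_derivative_along_line[where S = ?S])
          (auto intro!: Sym_add Sym_scaleR)
      moreover have "((\<lambda>r. G t x ?y ?z (?\<gamma> + r *\<^sub>R \<delta>)) has_field_derivative
          (G_gamma G t x ?y ?z ?\<gamma> \<bullet> \<delta>)) (at 0)"
        using G_gamma_props[OF G t mem] Sym mem by (intro Sym_line_deriv) auto
      ultimately show ?thesis
        by (simp add: g_def DERIV_unique)
    qed
    moreover have "\<bar>D (u, w, 0)\<bar> \<le> L * (\<bar>u\<bar> + norm w)"
    proof (rule abs_derivative_le_lipschitz[OF D])
      fix r :: real
      show "(?y, ?z, ?\<gamma>) + r *\<^sub>R (u, w, 0) \<in> ?S" using mem by simp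
      have "dist (G t x (?y + r * u) (?z + r *\<^sub>R w) ?\<gamma>) (G t x ?y ?z ?\<gamma>)
          \<le> L * dist (x, ?y + r * u, ?z + r *\<^sub>R w, ?\<gamma>) (x, ?y, ?z, ?\<gamma>)"
        using lipschitz_onD[OF lip, of "(x, ?y + r * u, ?z + r *\<^sub>R w, ?\<gamma>)" "(x, ?y, ?z, ?\<gamma>)"] mem
        by auto
      also have "dist (x, ?y + r * u, ?z + r *\<^sub>R w, ?\<gamma>) (x, ?y, ?z, ?\<gamma>) = norm (r * u, r *\<^sub>R w)"
        by (simp add: dist_prod_def norm_prod_def dist_norm)
      also have "L * \<dots> \<le> L * ((\<bar>u\<bar> + norm w) * \<bar>r\<bar>)"
        using norm_Pair_le[of "r * u" "r *\<^sub>R w"] lipschitz_on_nonneg[OF lip]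
        by (intro mult_left_mono) (simp_all add: abs_mult algebra_simps)
      finally show "\<bar>g ((?y, ?z, ?\<gamma>) + r *\<^sub>R (u, w, 0)) - g (?y, ?z, ?\<gamma>)\<bar>
          \<le> L * (\<bar>u\<bar> + norm w) * \<bar>r\<bar>"
        by (simp add: g_def dist_real_def mult.assoc)
    qed
    then have "h * (- (L * (\<bar>u\<bar> + norm w))) \<le> h * D (u, w, 0)"
      using h by (intro mult_left_mono) auto
    ultimately have "0 \<le> u + h * (D W - (1/2) * (A \<bullet> \<delta>))"
      using pos[OF mem, of ?y ?z s] unfolding DW A_def[symmetric]
      by (simp add: inner_diff_left algebra_simps)
    with der show ?thesis by blast
  qed
  then have "f 0 \<le> f 1"
    by (intro DERIV_nonneg_imp_nondecreasing[of 0 1 f]) auto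
  then show ?thesis
    by (simp add: f_def g_def P_def W_def F_nl_def frob_eq_inner A_def)
qed


text \<open>The differences of \<open>D0\<close>, \<open>D1\<close> and \<open>D2\<close> between
  \<psi> and \<phi> are sums of 1, \<open>K1\<close> and \<open>K2\<close> over the atoms with
  common nonnegative coefficients \<open>w\<close>. The condition \<open>pos\<close> of
  \<open>F_nl_increment\<close> thus follows by summing the condition \<open>weight\<close> over the
  atoms.\<close>

lemma Th_le:
  fixes G :: "'n::finite nonlin"
  assumes G: "G_differentiable T G" and t: "t \<in> {0..T}"
    and lip: "L-lipschitz_on (UNIV \<times> UNIV \<times> UNIV \<times> Sym) (\<lambda>(x, y, z, \<gamma>). G t x y z \<gamma>)"
    and h: "h > 0" and p: "0 < p t x" "p t x < 1" and le: "\<And>x. \<phi> x \<le> \<psi> x"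
    and weight: "\<And>y z \<gamma> \<xi>. \<gamma> \<in> Sym \<Longrightarrow> \<xi> \<in> set_pmf (xi_pmf (p t x)) \<Longrightarrow>
      0 \<le> 1 - h * L * (1 + norm (K1 h (\<sigma> t x) \<xi>))
        + h * ((G_gamma G t x y z \<gamma> - (1/2) *\<^sub>R (\<sigma> t x ** transpose (\<sigma> t x)))
               \<bullet> K2 h (\<sigma> t x) (p t x) \<xi>)"
  shows "Th G \<sigma> p h t \<phi> x \<le> Th G \<sigma> p h t \<psi> x"
proof -
  define S where "S = \<sigma> t x"
  define q where "q = p t x"
  define M :: "(real^'n) pmf" where "M = xi_pmf q"
  define pos where "pos = (\<lambda>\<xi>. x + sqrt h *\<^sub>R (S *v \<xi>))"
  have fin: "finite (set_pmf M)"
    unfolding M_def q_def using p by (rule finite_set_xi_pmf)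
  define w where "w = (\<lambda>\<xi>. pmf M \<xi> * (\<psi> (pos \<xi>) - \<phi> (pos \<xi>)))"
  have w: "0 \<le> w \<xi>" for \<xi>
    using le by (simp add: w_def)
  define u where "u = (\<Sum>\<xi>\<in>set_pmf M. w \<xi>)"
  define v where "v = (\<Sum>\<xi>\<in>set_pmf M. w \<xi> *\<^sub>R K1 h S \<xi>)"
  define \<delta> where "\<delta> = (\<Sum>\<xi>\<in>set_pmf M. w \<xi> *\<^sub>R K2 h S q \<xi>)"
  have D0: "D0 h S q f x = (\<Sum>\<xi>\<in>set_pmf M. pmf M \<xi> * f (pos \<xi>))" for f
    unfolding D0_def M_def[symmetric] pos_def[symmetric]
    by (subst integral_measure_pmf[OF fin]) (auto simp: pos_def)
  have D1: "D1 h S q f x = (\<Sum>\<xi>\<in>set_pmf M. (pmf M \<xi> * f (pos \<xi>)) *\<^sub>R K1 h S \<xi>)" for f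
    unfolding D1_def M_def[symmetric] pos_def[symmetric]
    by (subst integral_measure_pmf[OF fin]) (auto simp: pos_def)
  have D2: "D2 h S q f x = (\<Sum>\<xi>\<in>set_pmf M. (pmf M \<xi> * f (pos \<xi>)) *\<^sub>R K2 h S q \<xi>)" for f
    unfolding D2_def M_def[symmetric] pos_def[symmetric]
    by (subst integral_measure_pmf[OF fin]) (auto simp: pos_def)
  have step: "D0 h S q \<psi> x = D0 h S q \<phi> x + u" "D1 h S q \<psi> x = D1 h S q \<phi> x + v"
    "D2 h S q \<psi> x = D2 h S q \<phi> x + \<delta>"
    unfolding D0 D1 D2 u_def v_def \<delta>_def w_def
    by (simp_all add: sum.distrib[symmetric] scaleR_left_distrib[symmetric] right_diff_distrib)
  have Sym: "D2 h S q \<phi> x \<in> Sym" "\<delta> \<in> Sym"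
    unfolding D2 \<delta>_def by (intro Sym_sum Sym_scaleR K2_Sym)+
  have "0 \<le> u - h * L * (\<bar>u\<bar> + norm v) + h * ((G_gamma G t x y z \<gamma> - (1/2) *\<^sub>R (S ** transpose S)) \<bullet> \<delta>)"
    if "\<gamma> \<in> Sym" for y z \<gamma>
  proof -
    define B where "B = G_gamma G t x y z \<gamma> - (1/2) *\<^sub>R (S ** transpose S)"
    have "0 \<le> (\<Sum>\<xi>\<in>set_pmf M. w \<xi> * (1 - h * L * (1 + norm (K1 h S \<xi>)) + h * (B \<bullet> K2 h S q \<xi>)))"
      using weight[OF that] w unfolding B_def S_def q_def M_def
      by (intro sum_nonneg mult_nonneg_nonneg) auto
    also have "\<dots> = u - h * L * (u + (\<Sum>\<xi>\<in>set_pmf M. norm (w \<xi> *\<^sub>R K1 h S \<xi>))) + h * (B \<bullet> \<delta>)"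
      using w unfolding u_def \<delta>_def
      by (simp add: algebra_simps sum.distrib sum_subtractf sum_distrib_left inner_sum_right)
    \<comment> \<open>Triangle inequality for \<open>v\<close>, in the direction that enlarges the
      right-hand side.\<close>
    also have "\<dots> \<le> u - h * L * (u + norm v) + h * (B \<bullet> \<delta>)"
      using h lipschitz_on_nonneg[OF lip] unfolding v_def
      by (intro add_mono diff_mono mult_left_mono norm_sum) auto
    finally show ?thesis
      using w by (simp add: B_def u_def sum_nonneg)
  qed
  then have "D0 h S q \<phi> x + h * F_nl G \<sigma> t x (D0 h S q \<phi> x) (D1 h S q \<phi> x) (D2 h S q \<phi> x)
    \<le> (D0 h S q \<phi> x + u)
      + h * F_nl G \<sigma> t x (D0 h S q \<phi> x + u) (D1 h S q \<phi> x + v) (D2 h S q \<phi> x + \<delta>)"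
    using h Sym unfolding S_def by (intro F_nl_increment[OF G t lip]) auto
  then show ?thesis
    by (simp add: Th_def Let_def step flip: S_def q_def)
qed

text \<open>Apply \<open>S ** matrix_inv S\<close> to a basis vector. This lets the zero-order error
  be absorbed into a multiple of the norm of the inverse.\<close>

lemma one_le_norm_matrix_inv:
  fixes S :: "real^'n::finite^'n"
  assumes "invertible S"
  shows "1 \<le> norm S * norm (matrix_inv S)"
proof -
  fix i :: 'n
  have "S *v (matrix_inv S *v axis i 1) = axis i 1"
    by (simp add: matrix_vector_mul_assoc matrix_inv_right_left[OF assms])
  then have "1 = norm (S *v (matrix_inv S *v axis i 1))"
    by simp
  also have "\<dots> \<le> norm S * (norm (matrix_inv S) * norm (axis i (1::real)))"
    by (meson norm_matrix_vector_mult_le norm_ge_zero mult_left_mono order_trans)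
  finally show ?thesis by simp
qed

section \<open>Positivity of the weights under the assumption\<close>

lemma M_pair_weight:
  fixes G :: "'n::finite nonlin" and \<sigma> :: "'n mfield" and p' :: "real \<Rightarrow> real^'n \<Rightarrow> real"
    and t l :: real and x :: "real^'n"
  defines "S \<equiv> \<sigma> t x" and "p \<equiv> p' t x"
  assumes C0: "alpha_high_const T G C0" and M: "M_pair T G \<sigma> p'" and t: "t \<in> {0..T}"
    and l: "0 < l" "ereal l \<le> lambda_star T G \<sigma> / 2"
    and h: "h > 0" and \<gamma>: "\<gamma> \<in> Sym" and \<xi>: "\<xi> \<in> set_pmf (xi_pmf p)"
  shows "l * norm (matrix_inv S) / sqrt p \<le>
    1 + h * ((G_gamma G t x y z \<gamma> - (1/2) *\<^sub>R (S ** transpose S)) \<bullet> K2 h S p \<xi>)"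
proof -
  define d where "d = real CARD('n)"
  define R where "R = matrix_inv S"
  define B where "B = Gt_gamma G \<sigma> t x y z \<gamma>"
  define c where "c = c_p G \<sigma> t x p"
  define q where "q = alpha_p G \<sigma> t x p"
  have inv: "\<forall>t\<in>{0..T}. \<forall>x. invertible (\<sigma> t x)"
    using M by (simp add: M_pair_def admissible_sigma_def)
  then have invS: "invertible S" using t by (simp add: S_def)
  have Rpos: "norm R > 0"
    unfolding R_def using invS by (rule norm_matrix_inv_pos)
  have p_range: "p \<in> p_range G \<sigma> t x"
    and lam: "lambda_star T G \<sigma> / 2 \<le> ereal (lambda_p G \<sigma> t x p)"
    and low: "alpha_low G \<sigma> t x = ereal (c powi (-2))"
    and th2: "theta G \<sigma> t x \<le> 2"
    using M t by (auto simp: M_pair_def M2_def M1_def p_def c_def)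
  note p = alpha_p_bounds[OF p_range] and cb = c_p_bounds[OF p_range]
  have lam: "l \<le> lambda_p G \<sigma> t x p"
    using order_trans[OF l(2) lam] by simp
  \<comment> \<open>Division by zero yields 0, so \<open>lambda_p\<close> would vanish for
    \<open>c = 0\<close>, against \<open>0 < l\<close>.\<close>
  have "c \<noteq> 0"
    using lam l(1) by (auto simp: lambda_p_def Let_def c_def[symmetric])
  with cb(1) have c: "c > 0" by (simp add: c_def)
  define a where "a = 1 / c\<^sup>2"
  have low: "alpha_low G \<sigma> t x = ereal a"
    using low c by (simp add: a_def power_int_minus field_simps)
  have "alpha_high G \<sigma> t x \<le> ereal (C0 * (norm R)\<^sup>2)"
    using C0 inv t unfolding alpha_high_const_def R_def S_def by blast
  then obtain b where high: "alpha_high G \<sigma> t x = ereal b"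
    using alpha_high_nonneg[of G \<sigma> t x] by (cases "alpha_high G \<sigma> t x") auto
  obtain \<theta> where th: "theta G \<sigma> t x = ereal \<theta>"
    using th2 theta_nonneg[of G \<sigma> t x] by (cases "theta G \<sigma> t x") auto
  have \<theta>: "\<theta> \<ge> 0"
    using theta_nonneg[of G \<sigma> t x] by (simp add: th)
  have Lam: "Lam G \<sigma> t x = b * c\<^sup>2"
    by (simp add: Lam_def low high a_def)
  \<comment> \<open>Divided by the square of \<open>c\<close>, the definition of \<open>c_p\<close>
    becomes the relation \<open>ab\<close> of \<open>K2_weight_bound\<close>. This is where the
    normalisation of \<open>alpha_low\<close> enters.\<close>
  have "c\<^sup>2 = 2 * p * (b * c\<^sup>2) + q - 2 * p"
    using cb(2) by (simp add: c_def[symmetric] q_def[symmetric] Lam)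
  then have "a * c\<^sup>2 = a * (2 * p * (b * c\<^sup>2) + q - 2 * p)"
    by simp
  moreover have ac: "a * c\<^sup>2 = 1" using c by (simp add: a_def)
  ultimately have ab: "a * (q - 2 * p) + 2 * p * b = 1"
    by (simp add: algebra_simps)
  have "1 - p + p * d - 2 * p * d * b \<le> 1 - p + ((1 - p) * (\<xi> \<bullet> (B *v \<xi>))
      - (1 - 3 * p) * (\<Sum>i\<in>UNIV. B $ i $ i * (\<xi> $ i)\<^sup>2)
      - 2 * p * (\<Sum>i\<in>UNIV. B $ i $ i) - p * (\<Sum>i\<in>UNIV. (\<xi> $ i)\<^sup>2) + p * d)"
    unfolding d_def
  proof (rule K2_weight_bound[OF p(1,2) \<theta>])
    show "q = (p * (2 + 3 * \<theta>) - \<theta>) / (p * (1 + \<theta>))"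
      by (simp add: q_def alpha_p_def th)
    show "2 * p \<le> q" using p(3) by (simp add: q_def)
    show "a \<le> B $ i $ i" "B $ i $ i \<le> b" for i
      using alpha_low_le_diag[OF \<gamma>, of G \<sigma> t x y z i] diag_le_alpha_high[OF \<gamma>, of G \<sigma> t x y z i]
      by (simp_all add: low high B_def)
    show "(\<Sum>i\<in>UNIV. B $ i $ i * (\<xi> $ i)\<^sup>2) \<le> (1 + \<theta>) * (\<xi> \<bullet> (B *v \<xi>))"
      unfolding B_def by (rule theta_quadform[OF th \<gamma>])
    show "\<xi> $ i = 0 \<or> p * (\<xi> $ i)\<^sup>2 = 1" for i
      using p \<xi> by (intro xi_pmf_component) auto
  qed (rule ab)
  also have "\<dots> = (1 - p) * (1 + h * ((G_gamma G t x y z \<gamma> - (1/2) *\<^sub>R (S ** transpose S)) \<bullet> K2 h S p \<xi>))"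
    using inner_K2_eq[OF invS h, of p "G_gamma G t x y z \<gamma>" \<xi>] p(1,2)
    by (simp add: B_def Gt_gamma_def S_def d_def algebra_simps)
  finally have W: "1 - p + p * d - 2 * p * d * b
      \<le> (1 - p) * (1 + h * ((G_gamma G t x y z \<gamma> - (1/2) *\<^sub>R (S ** transpose S)) \<bullet> K2 h S p \<xi>))" .
  have sqrt_a: "sqrt a = 1 / c"
    using c by (simp add: a_def real_sqrt_divide)
  have "lambda_p G \<sigma> t x p = sqrt p * (1 - p + p * d - 2 * p * d * b) / norm R"
    using c Rpos unfolding lambda_p_def Let_def c_def[symmetric] d_def[symmetric] Lam low S_def[symmetric]
      R_def[symmetric] real_of_ereal.simps sqrt_a
    by (simp add: field_simps power2_eq_square)
  with lam have "l * norm R \<le> sqrt p * (1 - p + p * d - 2 * p * d * b)"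
    using Rpos by (simp add: field_simps)
  then have *: "l * norm R / sqrt p \<le> 1 - p + p * d - 2 * p * d * b"
    using p(1) by (simp add: field_simps)
  \<comment> \<open>The bound concerns \<open>(1 - p) * X\<close>. Since it is nonnegative, so is
    \<open>X\<close>, and the factor 1 - p \<le> 1 may be dropped.\<close>
  have nonneg: "0 \<le> l * norm R / sqrt p" using l p(1) by simp
  define X where "X = 1 + h * ((G_gamma G t x y z \<gamma> - (1/2) *\<^sub>R (S ** transpose S)) \<bullet> K2 h S p \<xi>)"
  have X: "l * norm R / sqrt p \<le> (1 - p) * X"
    using * W unfolding X_def by linarith
  have "0 \<le> X"
    using order_trans[OF nonneg X] p(2) by (simp add: zero_le_mult_iff)
  then have "(1 - p) * X \<le> 1 * X"
    using p(1) by (intro mult_right_mono) auto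
  with X show ?thesis unfolding X_def R_def by simp
qed

lemma M_pair_monotone:
  fixes G :: "'n::finite nonlin"
  assumes T: "T > 0" and G: "G_differentiable T G" "S2 T G g" and C0: "alpha_high_const T G C0"
    and M: "M_pair T G \<sigma> p"
  shows "\<exists>h0>0. \<forall>h\<in>{0<..h0}. Th_monotone T G \<sigma> p h"
proof -
  define d where "d = real CARD('n)"
  obtain L where lip: "\<And>t. t \<in> {0..T} \<Longrightarrow>
      L-lipschitz_on (UNIV \<times> UNIV \<times> UNIV \<times> Sym) (\<lambda>(x, y, z, \<gamma>). G t x y z \<gamma>)"
    using G(2) unfolding S2_def by blast
  have L: "L \<ge> 0"
    using lipschitz_on_nonneg[OF lip[of 0]] T by simp
  have "bounded ((\<lambda>(t, x). \<sigma> t x) ` ({0..T} \<times> UNIV))"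
    using M by (simp add: M_pair_def admissible_sigma_def)
  then obtain s where s: "s > 0" "\<And>t x. t \<in> {0..T} \<Longrightarrow> norm (\<sigma> t x) \<le> s"
    unfolding bounded_pos by auto
  \<comment> \<open>At this point \<open>lambda_star\<close> may still be \<infinity>, so a positive
    real \<open>l\<close> below its half is taken instead.\<close>
  have "0 < lambda_star T G \<sigma> / 2"
    using M by (cases "lambda_star T G \<sigma>") (auto simp: M_pair_def M1_def ereal_divide_less_iff)
  then obtain l where l: "0 < l" "ereal l \<le> lambda_star T G \<sigma> / 2"
    using ereal_dense2 by (metis ereal_less(2) less_imp_le)
  \<comment> \<open>\<open>k\<close> collects the errors: the first summand comes from
    \<open>K1\<close>, the second from the zero-order term.\<close>
  define k where "k = L * sqrt d + L * s"
  have k: "k \<ge> 0" unfolding k_def d_def using L s by simp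
  \<comment> \<open>The threshold for \<open>h\<close> is the square of \<open>r\<close>: then
    \<open>sqrt h \<le> r\<close>, the bound by 1 gives \<open>h \<le> sqrt h\<close>, and
    \<open>r * k \<le> l\<close> lets the weight dominate the error.\<close>
  define r where "r = min 1 (l / (k + 1))"
  have r: "0 < r" "r \<le> 1" "r * k \<le> l"
  proof -
    show "0 < r" "r \<le> 1" using l k by (simp_all add: r_def)
    have "r \<le> l / (k + 1)" by (simp add: r_def)
    then have "r * (k + 1) \<le> l"
      using k by (simp add: le_divide_eq)
    with \<open>0 < r\<close> show "r * k \<le> l" by (simp add: algebra_simps)
  qed
  have "Th_monotone T G \<sigma> p h" if h: "0 < h" "h \<le> r\<^sup>2" for h
    unfolding Th_monotone_def
  proof (intro allI impI)
    fix t :: real and \<phi> \<psi> :: "real^'n \<Rightarrow> real" and x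
    assume *: "0 \<le> t \<and> t < T \<and> t + h \<le> T \<and>
      \<phi> \<in> borel_measurable borel \<and> bounded (range \<phi>) \<and>
      \<psi> \<in> borel_measurable borel \<and> bounded (range \<psi>) \<and> (\<forall>x. \<phi> x \<le> \<psi> x)"
    then have t: "t \<in> {0..T}" by simp
    have "p t x \<in> p_range G \<sigma> t x"
      using M t by (auto simp: M_pair_def M2_def)
    then have p: "0 < p t x" "p t x < 1"
      using alpha_p_bounds by fastforce+
    define R where "R = norm (matrix_inv (\<sigma> t x))"
    have sh: "sqrt h \<le> r" "0 < sqrt h"
      using h r(1) by (simp_all add: real_le_lsqrt)
    have hh: "h \<le> sqrt h"
    proof -
      have "sqrt h * sqrt h \<le> sqrt h * 1"
        using order_trans[OF sh(1) r(2)] sh(2) by (intro mult_left_mono) simp_all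
      then show ?thesis using h by simp
    qed
    show "Th G \<sigma> p h t \<phi> x \<le> Th G \<sigma> p h t \<psi> x"
    proof (rule Th_le[where p = p, OF G(1) t lip[OF t] h(1) p])
      show "\<phi> x \<le> \<psi> x" for x using * by blast
      fix y and z \<xi> :: "real^'n" and \<gamma> :: "real^'n^'n"
      assume \<gamma>: "\<gamma> \<in> Sym" and \<xi>: "\<xi> \<in> set_pmf (xi_pmf (p t x))"
      have "invertible (\<sigma> t x)"
        using M t by (simp add: M_pair_def admissible_sigma_def)
      from one_le_norm_matrix_inv[OF this] have "1 \<le> s * R"
        using s(2)[OF t, of x] unfolding R_def by (meson mult_right_mono norm_ge_zero order_trans)
      moreover have "1 * (s * R) \<le> 1 / sqrt (p t x) * (s * R)"
        using p s(1) by (intro mult_right_mono) (auto simp: R_def)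
      \<comment> \<open>Brings the zero-order error to the same form as the others, a multiple of
        \<open>R / sqrt (p t x)\<close>.\<close>
      ultimately have one: "1 \<le> s * (R / sqrt (p t x))" by simp
      have "sqrt h * norm (K1 h (\<sigma> t x) \<xi>) \<le> R * (sqrt d / sqrt (p t x))"
        unfolding R_def d_def using h p \<xi> by (intro norm_K1_le xi_pmf_component) auto
      then have *: "sqrt h * L * (sqrt h * norm (K1 h (\<sigma> t x) \<xi>))
          \<le> sqrt h * L * (R * (sqrt d / sqrt (p t x)))"
        using L h by (intro mult_left_mono) auto
      have "h * L * norm (K1 h (\<sigma> t x) \<xi>) = (sqrt h * sqrt h) * L * norm (K1 h (\<sigma> t x) \<xi>)"
        using h by simp
      also have "\<dots> = sqrt h * L * (sqrt h * norm (K1 h (\<sigma> t x) \<xi>))"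
        by (simp only: mult_ac)
      also note *
      also have "sqrt h * L * (R * (sqrt d / sqrt (p t x))) = sqrt h * L * sqrt d * (R / sqrt (p t x))"
        by simp
      finally have 1: "h * L * norm (K1 h (\<sigma> t x) \<xi>) \<le> sqrt h * L * sqrt d * (R / sqrt (p t x))" .
      have "h * L * 1 \<le> sqrt h * L * (s * (R / sqrt (p t x)))"
        using one L hh h by (intro mult_mono) auto
      with 1 have "h * L * (1 + norm (K1 h (\<sigma> t x) \<xi>)) \<le> sqrt h * k * (R / sqrt (p t x))"
        by (simp add: k_def algebra_simps)
      also have "\<dots> \<le> r * k * (R / sqrt (p t x))"
        using sh k p by (intro mult_right_mono) (auto simp: R_def)
      also have "\<dots> \<le> l * (R / sqrt (p t x))"
        using r(3) p by (intro mult_right_mono) (auto simp: R_def)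
      also have "\<dots> \<le> 1 + h * ((G_gamma G t x y z \<gamma> - (1/2) *\<^sub>R (\<sigma> t x ** transpose (\<sigma> t x)))
               \<bullet> K2 h (\<sigma> t x) (p t x) \<xi>)"
        using M_pair_weight[OF C0 M t l h(1) \<gamma> \<xi>, of y z] by (simp add: R_def)
      finally show "0 \<le> 1 - h * L * (1 + norm (K1 h (\<sigma> t x) \<xi>))
        + h * ((G_gamma G t x y z \<gamma> - (1/2) *\<^sub>R (\<sigma> t x ** transpose (\<sigma> t x)))
               \<bullet> K2 h (\<sigma> t x) (p t x) \<xi>)"
        by simp
    qed
  qed
  then show ?thesis
    using r(1) by (intro exI[of _ "r\<^sup>2"]) auto
qed


section \<open>Existence of an admissible pair\<close>

lemma alpha_low_scaled:
  assumes c: "c > 0"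
    and Gt: "\<And>y z \<gamma>. Gt_gamma G \<sigma>' t x y z \<gamma> = c *\<^sub>R Gt_gamma G \<sigma> t x y z \<gamma>"
  shows "alpha_low G \<sigma>' t x = ereal c * alpha_low G \<sigma> t x"
proof -
  \<comment> \<open>One inequality for all pairs of fields; the reverse one follows by swapping them.\<close>
  have le: "alpha_low G \<sigma> t x \<le> ereal (1 / c) * alpha_low G \<sigma>' t x"
    if c: "c > 0" and Gt: "\<And>y z \<gamma>. Gt_gamma G \<sigma>' t x y z \<gamma> = c *\<^sub>R Gt_gamma G \<sigma> t x y z \<gamma>"
    for c \<sigma> \<sigma>'
    unfolding alpha_low_def[of G \<sigma>]
  proof (intro Sup_least, clarify)
    fix \<alpha> :: real
    assume \<alpha>: "\<alpha> > 0" "\<forall>y z. \<forall>\<gamma>\<in>Sym. \<alpha> *\<^sub>R mat 1 \<preceq> diag_part (Gt_gamma G \<sigma> t x y z \<gamma>)"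
    have "(c * \<alpha>) *\<^sub>R mat 1 \<preceq> diag_part (Gt_gamma G \<sigma>' t x y z \<gamma>)" if "\<gamma> \<in> Sym" for y z \<gamma>
      using \<alpha>(2) that psd_le_scaleR_iff[OF c, of "\<alpha> *\<^sub>R mat 1" "diag_part (Gt_gamma G \<sigma> t x y z \<gamma>)"]
      by (simp add: Gt diag_part_scaleR)
    then have "ereal (c * \<alpha>) \<le> alpha_low G \<sigma>' t x"
      unfolding alpha_low_def using c \<alpha>(1) by (intro Sup_upper imageI) simp
    then have "ereal (1 / c) * ereal (c * \<alpha>) \<le> ereal (1 / c) * alpha_low G \<sigma>' t x"
      using c by (intro ereal_mult_left_mono) auto
    then show "ereal \<alpha> \<le> ereal (1 / c) * alpha_low G \<sigma>' t x"
      using c by simp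
  qed
  have "ereal c * alpha_low G \<sigma> t x \<le> ereal c * (ereal (1 / c) * alpha_low G \<sigma>' t x)"
    using le[OF assms] c by (intro ereal_mult_left_mono) auto
  also have "\<dots> = alpha_low G \<sigma>' t x"
    using c by (simp add: mult.assoc[symmetric] one_ereal_def[symmetric])
  finally have "ereal c * alpha_low G \<sigma> t x \<le> alpha_low G \<sigma>' t x" .
  moreover have "alpha_low G \<sigma>' t x \<le> ereal c * alpha_low G \<sigma> t x"
    using le[of "1 / c" \<sigma> \<sigma>'] c by (simp add: Gt)
  ultimately show ?thesis by (rule antisym[rotated])
qed

lemma alpha_high_scaled:
  assumes c: "c > 0"
    and Gt: "\<And>y z \<gamma>. Gt_gamma G \<sigma>' t x y z \<gamma> = c *\<^sub>R Gt_gamma G \<sigma> t x y z \<gamma>"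
  shows "alpha_high G \<sigma>' t x = ereal c * alpha_high G \<sigma> t x"
proof -
  have le: "ereal (1 / c) * alpha_high G \<sigma>' t x \<le> alpha_high G \<sigma> t x"
    if c: "c > 0" and Gt: "\<And>y z \<gamma>. Gt_gamma G \<sigma>' t x y z \<gamma> = c *\<^sub>R Gt_gamma G \<sigma> t x y z \<gamma>"
    for c \<sigma> \<sigma>'
    unfolding alpha_high_def[of G \<sigma>]
  proof (intro Inf_greatest, clarify)
    fix \<alpha> :: real
    assume \<alpha>: "\<alpha> > 0" "\<forall>y z. \<forall>\<gamma>\<in>Sym. diag_part (Gt_gamma G \<sigma> t x y z \<gamma>) \<preceq> \<alpha> *\<^sub>R mat 1"
    have "diag_part (Gt_gamma G \<sigma>' t x y z \<gamma>) \<preceq> (c * \<alpha>) *\<^sub>R mat 1" if "\<gamma> \<in> Sym" for y z \<gamma>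
      using \<alpha>(2) that psd_le_scaleR_iff[OF c, of "diag_part (Gt_gamma G \<sigma> t x y z \<gamma>)" "\<alpha> *\<^sub>R mat 1"]
      by (simp add: Gt diag_part_scaleR)
    then have "alpha_high G \<sigma>' t x \<le> ereal (c * \<alpha>)"
      unfolding alpha_high_def using c \<alpha>(1) by (intro Inf_lower imageI) simp
    then have "ereal (1 / c) * alpha_high G \<sigma>' t x \<le> ereal (1 / c) * ereal (c * \<alpha>)"
      using c by (intro ereal_mult_left_mono) auto
    then show "ereal (1 / c) * alpha_high G \<sigma>' t x \<le> ereal \<alpha>"
      using c by simp
  qed
  have "ereal c * (ereal (1 / c) * alpha_high G \<sigma>' t x) \<le> ereal c * alpha_high G \<sigma> t x"
    using le[OF assms] c by (intro ereal_mult_left_mono) auto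
  moreover have "ereal c * (ereal (1 / c) * alpha_high G \<sigma>' t x) = alpha_high G \<sigma>' t x"
    using c by (simp add: mult.assoc[symmetric] one_ereal_def[symmetric])
  moreover have "ereal c * alpha_high G \<sigma> t x \<le> alpha_high G \<sigma>' t x"
    using le[of "1 / c" \<sigma> \<sigma>'] c by (simp add: Gt)
  ultimately show ?thesis by (intro antisym) simp_all
qed

text \<open>Both sides of the inequality defining \<open>theta\<close> are linear in
  \<open>Gt_gamma\<close>, so the factor cancels.\<close>

lemma theta_scaled:
  assumes c: "c > 0"
    and Gt: "\<And>y z \<gamma>. Gt_gamma G \<sigma>' t x y z \<gamma> = c *\<^sub>R Gt_gamma G \<sigma> t x y z \<gamma>"
  shows "theta G \<sigma>' t x = theta G \<sigma> t x"
proof -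
  have "(1 + \<theta>) *\<^sub>R c *\<^sub>R A = c *\<^sub>R (1 + \<theta>) *\<^sub>R A" for \<theta> and A :: "real^'a^'a"
    by (simp add: mult.commute)
  then show ?thesis
    unfolding theta_def by (simp only: Gt diag_part_scaleR psd_le_scaleR_iff[OF c])
qed

text \<open>\<open>Gt_gamma\<close> is homogeneous of degree -2 in the field. Hence the ratio
  \<open>Lam\<close> is invariant, and in \<open>lambda_p\<close> the factors 1/k from the root of
  \<open>alpha_low\<close> and from the norm of the inverse cancel. Only the values at
  \<open>(t, x)\<close> matter, so \<open>k\<close> may vary with the point.\<close>

lemma quantities_scaled:
  fixes G :: "'n::finite nonlin"
  assumes k: "k > 0" and inv: "invertible (\<sigma> t x)" and \<sigma>': "\<sigma>' t x = k *\<^sub>R \<sigma> t x"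
  shows "alpha_low G \<sigma>' t x = ereal (1 / k\<^sup>2) * alpha_low G \<sigma> t x"
    and "theta G \<sigma>' t x = theta G \<sigma> t x"
    and "p_range G \<sigma>' t x = p_range G \<sigma> t x"
    and "c_p G \<sigma>' t x p = c_p G \<sigma> t x p"
    and "lambda_p G \<sigma>' t x p = lambda_p G \<sigma> t x p"
proof -
  have R: "matrix_inv (\<sigma>' t x) = (1 / k) *\<^sub>R matrix_inv (\<sigma> t x)"
    unfolding \<sigma>' using inv k by (intro matrix_inv_scaleR) auto
  have Gt: "Gt_gamma G \<sigma>' t x y z \<gamma> = (1 / k\<^sup>2) *\<^sub>R Gt_gamma G \<sigma> t x y z \<gamma>" for y z \<gamma>
    by (simp add: Gt_gamma_def R transpose_scaleR scaleR_matrix_mult power2_eq_square)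
  have k2: "0 < 1 / k\<^sup>2" using k by simp
  show low: "alpha_low G \<sigma>' t x = ereal (1 / k\<^sup>2) * alpha_low G \<sigma> t x"
    by (rule alpha_low_scaled[OF k2 Gt])
  have high: "alpha_high G \<sigma>' t x = ereal (1 / k\<^sup>2) * alpha_high G \<sigma> t x"
    by (rule alpha_high_scaled[OF k2 Gt])
  show th: "theta G \<sigma>' t x = theta G \<sigma> t x"
    by (rule theta_scaled[OF k2 Gt])
  then show "p_range G \<sigma>' t x = p_range G \<sigma> t x"
    by (simp add: p_range_def)
  have Lam: "Lam G \<sigma>' t x = Lam G \<sigma> t x"
    using k by (simp add: Lam_def low high real_of_ereal_mult)
  show c: "c_p G \<sigma>' t x p = c_p G \<sigma> t x p"
    by (simp add: c_p_def alpha_p_def th Lam)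
  have "sqrt (real_of_ereal (alpha_low G \<sigma>' t x)) = sqrt (real_of_ereal (alpha_low G \<sigma> t x)) / k"
    using k by (simp add: low real_of_ereal_mult real_sqrt_divide)
  moreover have "norm (matrix_inv (\<sigma>' t x)) = norm (matrix_inv (\<sigma> t x)) / k"
    using k by (simp add: R)
  ultimately show "lambda_p G \<sigma>' t x p = lambda_p G \<sigma> t x p"
    using k by (simp add: lambda_p_def Let_def c Lam)
qed

section \<open>Lower and upper estimates of lambda_p\<close>

text \<open>From \<theta> \<le> p follows \<open>alpha_p\<close> \<ge> 1 and hence
  \<open>c_p\<close> \<ge> 1, while \<open>pb\<close> makes the subtracted term at most 1/2. So the
  bracket in \<open>lambda_p\<close> is at least 1/2, and the remaining quotient is at least
  \<open>sqrt \<epsilon>\<close>.\<close>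

lemma lambda_p_ge:
  fixes G :: "'n::finite nonlin"
  assumes low: "alpha_low G \<sigma> t x = ereal a" and high: "alpha_high G \<sigma> t x = ereal b"
    and th: "theta G \<sigma> t x = ereal \<theta>"
    and R: "norm (matrix_inv (\<sigma> t x)) > 0"
    and \<epsilon>: "\<epsilon> > 0" "\<epsilon> * (norm (matrix_inv (\<sigma> t x)))\<^sup>2 \<le> a" "a \<le> b"
    and p: "p > 0" "p \<le> 1 / 3" "\<theta> \<le> p" and pb: "4 * p * real CARD('n) * b \<le> a"
  shows "p \<in> p_range G \<sigma> t x" and "sqrt p / 2 * sqrt \<epsilon> \<le> lambda_p G \<sigma> t x p"
proof -
  define d where "d = real CARD('n)"
  have d: "d \<ge> 1"
    by (simp add: d_def Suc_leI)
  have \<theta>: "0 \<le> \<theta>" using theta_nonneg[of G \<sigma> t x] by (simp add: th)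
  have "\<theta> * 1 \<le> \<theta> * (2 * (1 + \<theta>))"
    using \<theta> by (intro mult_left_mono) auto
  then have "\<theta> / (2 * (1 + \<theta>)) \<le> \<theta>"
    using \<theta> by (simp add: divide_le_eq)
  then show pr: "p \<in> p_range G \<sigma> t x"
    using p by (simp add: p_range_def th)
  define c where "c = c_p G \<sigma> t x p"
  have a: "a > 0"
    using \<epsilon>(1) R by (intro less_le_trans[OF _ \<epsilon>(2)]) simp
  have Lam: "Lam G \<sigma> t x = b / a" by (simp add: Lam_def low high)
  have "\<theta> \<le> p * (1 + 2 * \<theta>)"
    using p(1,3) \<theta> by (simp add: distrib_left add_increasing2)
  then have "1 * (p * (1 + \<theta>)) \<le> p * (2 + 3 * \<theta>) - \<theta>"
    by (simp add: algebra_simps)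
  then have "1 \<le> alpha_p G \<sigma> t x p"
    unfolding alpha_p_def th Let_def real_of_ereal.simps using p \<theta> by (subst le_divide_eq) simp
  moreover have "2 * p * 1 \<le> 2 * p * (b / a)"
    using p a \<epsilon>(3) by (intro mult_left_mono) auto
  ultimately have "1 \<le> c\<^sup>2"
    using c_p_bounds(2)[OF pr] by (simp add: c_def Lam)
  then have c: "1 \<le> c"
    using power2_le_imp_le[of 1 c] c_p_bounds(1)[OF pr] unfolding c_def by simp
  have "2 * p * d * (b / a) \<le> 1 / 2"
    using pb a by (simp add: d_def field_simps)
  then have "2 * p * d * (b / a) / c \<le> 1 / 2 / c"
    using c by (intro divide_right_mono) auto
  also have "\<dots> \<le> 1 / 2"
    using c by simp
  finally have "2 * p * d * (b / a) / c \<le> 1 / 2" .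
  moreover have "1 * 1 \<le> (1 - p + p * d) * c"
    using p d c by (intro mult_mono) (simp_all add: add_increasing)
  ultimately have br: "1 / 2 \<le> (1 - p + p * d) * c - 2 * p * d * (b / a) / c"
    by simp
  have "sqrt (\<epsilon> * (norm (matrix_inv (\<sigma> t x)))\<^sup>2) \<le> sqrt a"
    using \<epsilon>(2) by simp
  then have "sqrt \<epsilon> \<le> sqrt a / norm (matrix_inv (\<sigma> t x))"
    using R by (simp add: real_sqrt_mult le_divide_eq)
  then have "sqrt p * (1 / 2) * sqrt \<epsilon> \<le> sqrt p * ((1 - p + p * d) * c - 2 * p * d * (b / a) / c)
      * (sqrt a / norm (matrix_inv (\<sigma> t x)))"
    using br p \<epsilon>(1) by (intro mult_mono) auto
  then show "sqrt p / 2 * sqrt \<epsilon> \<le> lambda_p G \<sigma> t x p"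
    by (simp add: lambda_p_def Let_def Lam low c_def d_def)
qed

text \<open>Drop the subtracted term and bound \<open>c_p\<close> through \<open>Lam\<close>. The
  surviving factor \<open>sqrt p\<close> is the point: a value of \<open>lambda_p\<close> bounded
  below keeps \<open>p\<close> away from 0.\<close>

lemma lambda_p_le:
  fixes G :: "'n::finite nonlin"
  assumes pr: "p \<in> p_range G \<sigma> t x" and low: "alpha_low G \<sigma> t x = ereal a"
    and R: "norm (matrix_inv (\<sigma> t x)) > 0"
    and C: "C > 0" "a \<le> C * (norm (matrix_inv (\<sigma> t x)))\<^sup>2" and Q: "Lam G \<sigma> t x \<le> Q"
  shows "lambda_p G \<sigma> t x p \<le> sqrt p * ((1 + real CARD('n)) * sqrt (Q + 2) * sqrt C)"
proof -
  define d where "d = real CARD('n)"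
  define c where "c = c_p G \<sigma> t x p"
  note p = alpha_p_bounds[OF pr]
  have c: "0 \<le> c" "c \<le> sqrt (Q + 2)"
    using c_p_bounds[OF pr] Q by (auto simp: c_def intro!: real_le_rsqrt)
  have a: "0 \<le> a" using alpha_low_real_nonneg[of G \<sigma> t x] by (simp add: low)
  have "p * d \<le> 1 * d" using p by (intro mult_right_mono) (auto simp: d_def)
  then have "1 - p + p * d \<le> 1 + d" using p by simp
  then have "(1 - p + p * d) * c \<le> (1 + d) * sqrt (Q + 2)"
    using c by (intro mult_mono) (auto simp: d_def)
  moreover have "0 \<le> 2 * p * d * Lam G \<sigma> t x / c"
    using p c Lam_nonneg[of G \<sigma> t x] by (simp add: d_def)
  ultimately have br: "(1 - p + p * d) * c - 2 * p * d * Lam G \<sigma> t x / c \<le> (1 + d) * sqrt (Q + 2)"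
    by linarith
  have "sqrt a \<le> sqrt (C * (norm (matrix_inv (\<sigma> t x)))\<^sup>2)"
    using C by simp
  then have sa: "sqrt a / norm (matrix_inv (\<sigma> t x)) \<le> sqrt C"
    using R by (simp add: real_sqrt_mult divide_le_eq)
  have "lambda_p G \<sigma> t x p = sqrt p * (((1 - p + p * d) * c - 2 * p * d * Lam G \<sigma> t x / c)
      * (sqrt a / norm (matrix_inv (\<sigma> t x))))"
    by (simp add: lambda_p_def Let_def low c_def d_def)
  also have "\<dots> \<le> sqrt p * ((1 + d) * sqrt (Q + 2) * (sqrt a / norm (matrix_inv (\<sigma> t x))))"
    using br a p by (intro mult_left_mono mult_right_mono) auto
  also have "\<dots> \<le> sqrt p * ((1 + d) * sqrt (Q + 2) * sqrt C)"
    using sa p order_trans[OF c] by (intro mult_left_mono) (auto simp: d_def)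
  finally show ?thesis by (simp add: d_def)
qed

section \<open>Choice of p and normalisation of the field\<close>

lemma bounded_stripI:
  assumes "\<And>t x. t \<in> I \<Longrightarrow> norm (f t x) \<le> B"
  shows "bounded ((\<lambda>(t, x). f t x) ` (I \<times> UNIV))"
  by (rule boundedI[of _ B]) (use assms in auto)

lemma M_pair_exists:
  fixes G :: "'n::finite nonlin" and \<sigma>0 :: "'n mfield"
  assumes T: "T > 0" and C0: "alpha_high_const T G C0" and adm: "admissible_sigma T \<sigma>0"
    and \<epsilon>: "\<epsilon> > 0"
    and th: "\<forall>t\<in>{0..T}. \<forall>x. theta G \<sigma>0 t x \<le> ereal (\<epsilon> / (4 * real CARD('n) * C0))"
    and low: "\<forall>t\<in>{0..T}. \<forall>x.
           alpha_low G \<sigma>0 t x / ereal ((norm (matrix_inv (\<sigma>0 t x)))\<^sup>2) \<ge> ereal \<epsilon>"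
  shows "\<exists>\<sigma> p. M_pair T G \<sigma> p"
proof -
  define d where "d = real CARD('n)"
  have d: "d \<ge> 1" by (simp add: d_def Suc_leI)
  have C0pos: "C0 > 0" using C0 by (simp add: alpha_high_const_def)
  define R where "R = (\<lambda>t x. norm (matrix_inv (\<sigma>0 t x)))"
  define a where "a = (\<lambda>t x. real_of_ereal (alpha_low G \<sigma>0 t x))"
  define b where "b = (\<lambda>t x. real_of_ereal (alpha_high G \<sigma>0 t x))"
  define \<theta> where "\<theta> = (\<lambda>t x. real_of_ereal (theta G \<sigma>0 t x))"
  have inv: "invertible (\<sigma>0 t x)" if "t \<in> {0..T}" for t x
    using adm that by (simp add: admissible_sigma_def)
  have Rpos: "R t x > 0" if "t \<in> {0..T}" for t x
    unfolding R_def using inv[OF that] by (rule norm_matrix_inv_pos)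
  have ab: "alpha_low G \<sigma>0 t x = ereal (a t x)" "alpha_high G \<sigma>0 t x = ereal (b t x)"
    "\<epsilon> * (R t x)\<^sup>2 \<le> a t x" "a t x \<le> b t x" "b t x \<le> C0 * (R t x)\<^sup>2"
    if t: "t \<in> {0..T}" for t x
  proof -
    have 1: "alpha_high G \<sigma>0 t x \<le> ereal (C0 * (R t x)\<^sup>2)"
      using C0 inv t unfolding alpha_high_const_def R_def by blast
    have "ereal \<epsilon> \<le> alpha_low G \<sigma>0 t x / ereal ((R t x)\<^sup>2)"
      using low t by (simp add: R_def)
    then have 2: "ereal (\<epsilon> * (R t x)\<^sup>2) \<le> alpha_low G \<sigma>0 t x"
      using Rpos[OF t, of x] by (subst (asm) ereal_le_divide_pos) (auto simp: mult.commute)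
    note 3 = alpha_low_le_high[of G \<sigma>0 t x]
    \<comment> \<open>Both quantities lie between two real numbers, which rules out infinite
      values.\<close>
    obtain r where r: "alpha_low G \<sigma>0 t x = ereal r"
      using 1 2 3 by (cases "alpha_low G \<sigma>0 t x") auto
    obtain s where s: "alpha_high G \<sigma>0 t x = ereal s"
      using 1 2 3 by (cases "alpha_high G \<sigma>0 t x") auto
    show "alpha_low G \<sigma>0 t x = ereal (a t x)" "alpha_high G \<sigma>0 t x = ereal (b t x)"
      "\<epsilon> * (R t x)\<^sup>2 \<le> a t x" "a t x \<le> b t x" "b t x \<le> C0 * (R t x)\<^sup>2"
      using 1 2 3 by (simp_all add: a_def b_def r s)
  qed
  have apos: "a t x > 0" if "t \<in> {0..T}" for t x
    using \<epsilon> Rpos[OF that, of x] by (intro less_le_trans[OF _ ab(3)[OF that, of x]]) simp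
  have thr: "theta G \<sigma>0 t x = ereal (\<theta> t x)" "\<theta> t x \<le> \<epsilon> / (4 * d * C0)"
    if t: "t \<in> {0..T}" for t x
  proof -
    have "theta G \<sigma>0 t x \<le> ereal (\<epsilon> / (4 * d * C0))" using th t by (simp add: d_def)
    then show "theta G \<sigma>0 t x = ereal (\<theta> t x)" "\<theta> t x \<le> \<epsilon> / (4 * d * C0)"
      using theta_nonneg[of G \<sigma>0 t x] by (cases "theta G \<sigma>0 t x"; simp add: \<theta>_def)+
  qed
  \<comment> \<open>A single point of the strip suffices to compare the constants: \<epsilon> \<le>
    \<open>C0\<close>, which keeps \<open>p0\<close> below 1/3.\<close>
  have "0 \<in> {0..T}" using T by simp
  note ab0 = ab[OF this, of 0] Rpos[OF this, of 0]
  have "\<epsilon> * (R 0 0)\<^sup>2 \<le> C0 * (R 0 0)\<^sup>2" using ab0 by linarith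
  then have \<epsilon>C: "\<epsilon> \<le> C0" using ab0(6) by simp
  define Q where "Q = C0 / \<epsilon>"
  have Lam: "1 \<le> Lam G \<sigma>0 t x" "Lam G \<sigma>0 t x \<le> Q" if t: "t \<in> {0..T}" for t x
  proof -
    have eq: "Lam G \<sigma>0 t x = b t x / a t x" by (simp add: Lam_def a_def b_def)
    then show "1 \<le> Lam G \<sigma>0 t x" using ab(4)[OF t, of x] apos[OF t, of x] by simp
    have "\<epsilon> * b t x \<le> \<epsilon> * (C0 * (R t x)\<^sup>2)"
      using ab(5)[OF t, of x] \<epsilon> by (intro mult_left_mono) auto
    also have "\<dots> = C0 * (\<epsilon> * (R t x)\<^sup>2)" by simp
    also have "\<dots> \<le> C0 * a t x"
      using ab(3)[OF t, of x] C0pos by (intro mult_left_mono) auto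
    finally show "Lam G \<sigma>0 t x \<le> Q"
      unfolding eq Q_def using apos[OF t, of x] \<epsilon> by (simp add: field_simps)
  qed
  \<comment> \<open>This is the assumed bound on \<theta>, so \<theta> \<le> \<open>p0\<close>;
    moreover \<open>4 * p0 * d = \<epsilon> / C0\<close>, which yields the condition
    \<open>pb\<close> of \<open>lambda_p_ge\<close>.\<close>
  define p0 where "p0 = \<epsilon> / (4 * d * C0)"
  have p0: "0 < p0" "p0 \<le> 1 / 3"
  proof -
    show "0 < p0" unfolding p0_def using \<epsilon> d C0pos by simp
    have "1 * \<epsilon> \<le> d * C0" using d \<epsilon>C C0pos \<epsilon> by (intro mult_mono) auto
    then show "p0 \<le> 1 / 3" unfolding p0_def using \<epsilon> d C0pos by (simp add: field_simps)
  qed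
  have ge: "p0 \<in> p_range G \<sigma>0 t x" "sqrt p0 / 2 * sqrt \<epsilon> \<le> lambda_p G \<sigma>0 t x p0"
    if t: "t \<in> {0..T}" for t x
  proof -
    have pb: "4 * p0 * real CARD('n) * b t x \<le> a t x"
    proof -
      have "4 * p0 * real CARD('n) = \<epsilon> / C0"
        using d by (simp add: p0_def d_def)
      moreover have "\<epsilon> / C0 * b t x \<le> \<epsilon> / C0 * (C0 * (R t x)\<^sup>2)"
        using ab(5)[OF t, of x] \<epsilon> C0pos by (intro mult_left_mono) auto
      ultimately show ?thesis using ab(3)[OF t, of x] C0pos by simp
    qed
    note * = lambda_p_ge[OF ab(1,2)[OF t] thr(1)[OF t] Rpos[OF t, unfolded R_def] \<epsilon>
        ab(3)[OF t, unfolded R_def] ab(4)[OF t] p0 thr(2)[OF t, folded p0_def] pb]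
    show "p0 \<in> p_range G \<sigma>0 t x" "sqrt p0 / 2 * sqrt \<epsilon> \<le> lambda_p G \<sigma>0 t x p0"
      by (fact *)+
  qed
  define U where "U = (1 + d) * sqrt (Q + 2) * sqrt C0"
  have Q: "Q > 0" unfolding Q_def using \<epsilon> C0pos by simp
  have U: "U > 0" unfolding U_def using d Q C0pos by simp
  have le: "lambda_p G \<sigma>0 t x p \<le> sqrt p * U" if t: "t \<in> {0..T}" and "p \<in> p_range G \<sigma>0 t x" for t x p
    unfolding U_def d_def
    using lambda_p_le[OF that(2) ab(1)[OF t] Rpos[OF t, unfolded R_def] C0pos _ Lam(2)[OF t]]
      ab(4,5)[OF t, of x] by (simp add: R_def)
  have "ereal (sqrt p0 / 2 * sqrt \<epsilon>) \<le> lambda_star T G \<sigma>0"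
    unfolding lambda_star_def using ge by (intro INF_greatest) (auto intro!: SUP_upper2[of p0])
  moreover have "lambda_star T G \<sigma>0 \<le> ereal U"
  proof -
    have "(SUP p \<in> p_range G \<sigma>0 0 0. ereal (lambda_p G \<sigma>0 0 0 p)) \<le> ereal U"
    proof (rule SUP_least)
      fix p assume p: "p \<in> p_range G \<sigma>0 0 0"
      have "sqrt p * U \<le> 1 * U"
        using alpha_p_bounds[OF p] U by (intro mult_right_mono) auto
      with le[OF \<open>0 \<in> {0..T}\<close> p] show "ereal (lambda_p G \<sigma>0 0 0 p) \<le> ereal U" by simp
    qed
    then show ?thesis
      unfolding lambda_star_def using T by (intro INF_lower2[of "(0, 0)"]) auto
  qed
  ultimately obtain l where l: "lambda_star T G \<sigma>0 = ereal l" "sqrt p0 / 2 * sqrt \<epsilon> \<le> l"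
    by (cases "lambda_star T G \<sigma>0") auto
  have lpos: "l > 0" using p0 \<epsilon> by (intro less_le_trans[OF _ l(2)]) simp
  \<comment> \<open>Since \<open>lambda_star\<close> is now a positive real, \<open>l / 2\<close>
    lies strictly below each supremum and is exceeded by some \<open>p\<close>, even if the supremum
    is not attained.\<close>
  have ex: "\<exists>p. p \<in> p_range G \<sigma>0 t x \<and> l / 2 \<le> lambda_p G \<sigma>0 t x p" if t: "t \<in> {0..T}" for t x
  proof -
    have "ereal (l / 2) < lambda_star T G \<sigma>0" using lpos by (simp add: l)
    also have "\<dots> \<le> (SUP p \<in> p_range G \<sigma>0 t x. ereal (lambda_p G \<sigma>0 t x p))"
      unfolding lambda_star_def using t by (intro INF_lower2[of "(t, x)"]) auto
    finally show ?thesis by (auto simp: less_SUP_iff intro: less_imp_le)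
  qed
  define p where "p = (\<lambda>t x. SOME p. p \<in> p_range G \<sigma>0 t x \<and> l / 2 \<le> lambda_p G \<sigma>0 t x p)"
  have p: "p t x \<in> p_range G \<sigma>0 t x" "l / 2 \<le> lambda_p G \<sigma>0 t x (p t x)" if t: "t \<in> {0..T}" for t x
    using someI_ex[OF ex[OF t]] by (auto simp: p_def)
  \<comment> \<open>Obtained by solving \<open>l / 2 \<le> sqrt p * U\<close> for
    \<open>p\<close>.\<close>
  define m where "m = (l / 2 / U)\<^sup>2"
  have m: "m > 0" unfolding m_def using lpos U by simp
  have p_ge: "m \<le> p t x" if t: "t \<in> {0..T}" for t x
  proof -
    have "l / 2 \<le> sqrt (p t x) * U" using p[OF t] le[OF t] by (meson order_trans)
    then have "l / 2 / U \<le> sqrt (p t x)" using U by (simp add: divide_le_eq)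
    then have "(l / 2 / U)\<^sup>2 \<le> (sqrt (p t x))\<^sup>2"
      using lpos U by (intro power_mono) auto
    then show ?thesis
      using less_imp_le[OF alpha_p_bounds(1)[OF p(1)[OF t, of x]]] by (simp add: m_def)
  qed
  define c where "c = (\<lambda>t x. c_p G \<sigma>0 t x (p t x))"
  have c: "sqrt (2 * m) \<le> c t x" "c t x \<le> sqrt (Q + 2)" if t: "t \<in> {0..T}" for t x
  proof -
    note pb = alpha_p_bounds[OF p(1)[OF t, of x]] and cb = c_p_bounds[OF p(1)[OF t, of x]]
    \<comment> \<open>As \<open>Lam\<close> \<ge> 1, the square of \<open>c_p\<close> is at least
      \<open>alpha_p\<close>, hence at least 2p.\<close>
    have "2 * p t x * 1 \<le> 2 * p t x * Lam G \<sigma>0 t x"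
      using Lam(1)[OF t] pb by (intro mult_left_mono) auto
    then have "2 * m \<le> (c t x)\<^sup>2"
      using cb(2) pb p_ge[OF t, of x] unfolding c_def by linarith
    then show "sqrt (2 * m) \<le> c t x"
      using cb(1) m by (intro real_le_lsqrt) (simp_all add: c_def)
    show "c t x \<le> sqrt (Q + 2)"
      using cb(3) Lam(2)[OF t, of x] by (intro real_le_rsqrt) (simp add: c_def)
  qed
  have cpos: "c t x > 0" if t: "t \<in> {0..T}" for t x
    using m by (intro less_le_trans[OF _ c(1)[OF t, of x]]) simp
  \<comment> \<open>Scaling by \<open>k\<close> turns \<open>alpha_low\<close> into \<open>a\<close>
    divided by the square of \<open>k\<close>, which is the inverse square of
    \<open>c\<close>.\<close>
  define k where "k = (\<lambda>t x. c t x * sqrt (a t x))"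
  have kpos: "k t x > 0" if t: "t \<in> {0..T}" for t x
    unfolding k_def using cpos[OF t, of x] apos[OF t, of x] by simp
  define \<sigma> where "\<sigma> = (\<lambda>t x. k t x *\<^sub>R \<sigma>0 t x)"
  have scaled: "alpha_low G \<sigma> t x = ereal (1 / (k t x)\<^sup>2 * a t x)"
    "theta G \<sigma> t x = theta G \<sigma>0 t x" "p_range G \<sigma> t x = p_range G \<sigma>0 t x"
    "c_p G \<sigma> t x q = c_p G \<sigma>0 t x q" "lambda_p G \<sigma> t x q = lambda_p G \<sigma>0 t x q"
    if t: "t \<in> {0..T}" for t x q
    using quantities_scaled[where \<sigma> = \<sigma>0 and \<sigma>' = \<sigma> and x = x, OF kpos[OF t, of x] inv[OF t, of x]]
      ab(1)[OF t, of x]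
    by (simp_all add: \<sigma>_def)
  have adm': "admissible_sigma T \<sigma>"
  proof -
    obtain B1 where B1: "B1 > 0" "\<And>t x. t \<in> {0..T} \<Longrightarrow> norm (\<sigma>0 t x) \<le> B1"
      using adm unfolding admissible_sigma_def bounded_pos by auto
    obtain B2 where B2: "B2 > 0" "\<And>t x. t \<in> {0..T} \<Longrightarrow> R t x \<le> B2"
      using adm unfolding admissible_sigma_def bounded_pos R_def by auto
    have norm_\<sigma>: "norm (\<sigma> t x) \<le> sqrt (Q + 2) * (sqrt C0 * B2) * B1" if t: "t \<in> {0..T}" for t x
    proof -
      have "sqrt (a t x) \<le> sqrt (C0 * (R t x)\<^sup>2)"
        using ab(4,5)[OF t, of x] by simp
      also have "\<dots> = sqrt C0 * R t x"
        using Rpos[OF t, of x] by (simp add: real_sqrt_mult)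
      also have "\<dots> \<le> sqrt C0 * B2"
        using B2(2)[OF t] C0pos by (intro mult_left_mono) auto
      finally have "k t x \<le> sqrt (Q + 2) * (sqrt C0 * B2)"
        unfolding k_def using c(2)[OF t, of x] apos[OF t, of x] Q by (intro mult_mono) auto
      then have "k t x * norm (\<sigma>0 t x) \<le> sqrt (Q + 2) * (sqrt C0 * B2) * B1"
        using B1(2)[OF t] Q C0pos B2(1) by (intro mult_mono) auto
      then show ?thesis using kpos[OF t, of x] by (simp add: \<sigma>_def)
    qed
    \<comment> \<open>\<open>k\<close> is bounded below by a constant multiple of \<open>R\<close>,
      so \<open>R\<close> cancels in the norm \<open>R / k\<close> of the new inverse.\<close>
    have norm_inv: "norm (matrix_inv (\<sigma> t x)) \<le> 1 / (sqrt (2 * m) * sqrt \<epsilon>)" if t: "t \<in> {0..T}" for t x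
    proof -
      have "sqrt (\<epsilon> * (R t x)\<^sup>2) \<le> sqrt (a t x)"
        using ab(3)[OF t, of x] by simp
      then have "sqrt \<epsilon> * R t x \<le> sqrt (a t x)"
        using Rpos[OF t, of x] by (simp add: real_sqrt_mult)
      then have "sqrt (2 * m) * (sqrt \<epsilon> * R t x) \<le> k t x"
        unfolding k_def using c(1)[OF t, of x] m cpos[OF t, of x] \<epsilon> Rpos[OF t, of x]
        by (intro mult_mono) auto
      moreover have w: "0 < sqrt (2 * m) * sqrt \<epsilon>"
        using m \<epsilon> by simp
      ultimately have "R t x \<le> k t x / (sqrt (2 * m) * sqrt \<epsilon>)"
        by (subst pos_le_divide_eq[OF w]) (simp add: mult_ac)
      then have "R t x / k t x \<le> 1 / (sqrt (2 * m) * sqrt \<epsilon>)"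
        by (subst pos_divide_le_eq[OF kpos[OF t, of x]]) simp
      moreover have "norm (matrix_inv (\<sigma> t x)) = R t x / k t x"
        using matrix_inv_scaleR(2)[OF inv[OF t, of x], of "k t x"] kpos[OF t, of x]
        by (simp add: \<sigma>_def R_def)
      ultimately show ?thesis by simp
    qed
    have "invertible (\<sigma> t x)" if t: "t \<in> {0..T}" for t x
      unfolding \<sigma>_def using inv[OF t] kpos[OF t, of x] by (intro matrix_inv_scaleR(1)) auto
    moreover have "bounded ((\<lambda>(t, x). \<sigma> t x) ` ({0..T} \<times> UNIV))"
      by (rule bounded_stripI) (rule norm_\<sigma>)
    moreover have "bounded ((\<lambda>(t, x). matrix_inv (\<sigma> t x)) ` ({0..T} \<times> UNIV))"
      by (rule bounded_stripI) (rule norm_inv)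
    ultimately show ?thesis
      by (simp add: admissible_sigma_def)
  qed
  have adm_p: "admissible_p T p"
  proof -
    have inv_p: "norm (inverse (p t x)) \<le> inverse m" if t: "t \<in> {0..T}" for t x
      using le_imp_inverse_le[OF p_ge[OF t, of x] m] alpha_p_bounds(1)[OF p(1)[OF t, of x]]
      by simp
    have "bounded ((\<lambda>(t, x). inverse (p t x)) ` ({0..T} \<times> UNIV))"
      by (rule bounded_stripI) (rule inv_p)
    moreover have "p t x \<in> {0<..<1}" if t: "t \<in> {0..T}" for t x
      using alpha_p_bounds[OF p(1)[OF t, of x]] by auto
    ultimately show ?thesis
      by (simp add: admissible_p_def)
  qed
  have star: "lambda_star T G \<sigma> = ereal l"
    unfolding l(1)[symmetric] lambda_star_def
    by (intro INF_cong) (auto simp: scaled)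
  have "M1 T G \<sigma>"
    unfolding M1_def
  proof (intro conjI ballI allI)
    fix t x assume t: "t \<in> {0..T}"
    have "\<theta> t x \<le> 2"
      using thr(2)[OF t, of x] p0 by (simp add: p0_def)
    then show "theta G \<sigma> t x \<le> 2"
      using thr(1)[OF t, of x] by (simp add: scaled[OF t])
  next
    show "0 < lambda_star T G \<sigma>" using lpos by (simp add: star)
  qed
  moreover have "M2 T G \<sigma> p"
    unfolding M2_def
  proof (intro conjI ballI allI)
    fix t x assume t: "t \<in> {0..T}"
    show "p t x \<in> p_range G \<sigma> t x"
      using p(1)[OF t] by (simp add: scaled[OF t])
    show "lambda_star T G \<sigma> / 2 \<le> ereal (lambda_p G \<sigma> t x (p t x))"
      using p(2)[OF t] by (simp add: scaled[OF t] star)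
    have "1 / (k t x)\<^sup>2 * a t x = c t x powi (- 2)"
      using apos[OF t, of x] cpos[OF t, of x]
      by (simp add: k_def power_mult_distrib power_int_minus divide_inverse)
    then show "alpha_low G \<sigma> t x = ereal (c_p G \<sigma> t x (p t x) powi (- 2))"
      by (simp add: scaled[OF t] c_def)
  qed
  ultimately have "M_pair T G \<sigma> p"
    using adm' adm_p by (simp add: M_pair_def)
  then show ?thesis by blast
qed

text \<open>The first conjunct guarantees that the second, which covers every admissible pair, is
  not vacuous.\<close>

theorem proposition3p7:
  fixes T C0 \<epsilon>0 :: real
    and G :: "'n::finite nonlin"
    and g :: "real^'n \<Rightarrow> real"
    and \<sigma>0 :: "'n mfield"
  assumes "T > 0"
    and "G_differentiable T G"
    and "S1 T G g" and "S2 T G g" and "S3 T G" and "S4 T G g"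
    and "alpha_high_const T G C0"
    and "admissible_sigma T \<sigma>0"
    and "\<epsilon>0 > 0"
    and "\<forall>t\<in>{0..T}. \<forall>x. theta G \<sigma>0 t x \<le> ereal (\<epsilon>0 / (4 * real CARD('n) * C0))"
    and "\<forall>t\<in>{0..T}. \<forall>x.
           alpha_low G \<sigma>0 t x / ereal ((norm (matrix_inv (\<sigma>0 t x)))\<^sup>2) \<ge> ereal \<epsilon>0"
  shows "assumption_M T G \<and>
         (\<forall>\<sigma> p. M_pair T G \<sigma> p \<longrightarrow> (\<exists>h0>0. \<forall>h\<in>{0<..h0}. Th_monotone T G \<sigma> p h))"
proof (intro conjI allI impI)
  show "assumption_M T G"
    unfolding assumption_M_def by (rule M_pair_exists[OF assms(1,7-11)])
  show "\<exists>h0>0. \<forall>h\<in>{0<..h0}. Th_monotone T G \<sigma> p h" if "M_pair T G \<sigma> p" for \<sigma> p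
    using assms(1,2,4,7) that by (rule M_pair_monotone)
qed

end
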